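(* There is a polynomial-time algorithm for \textsc{MinGMConn} which, on every instance $(P,D)$ with $n=|P|$, outputs a feasible solution $Q$ with $|Q|\le O(\sqrt{\log n})\cdot\mathrm{opt}(P,D)$.
   Context: For a finite set $X\subseteq\mathbb{R}^2$, two points $p,q\in X$ are M-connected in $X$ if there is a sequence $p=x_0,\dots,x_k=q$ of points of $X$ with consecutive points horizontally or vertically aligned and $\sum_{i}\|x_i-x_{i+1}\|_1=\|p-q\|_1$. An instance of \textsc{MinGMConn} consists of a finite set $P\subseteq\mathbb{Z}^2$ of input points, no two in the same row or column, and demands $D\subseteq P\times P$. A feasible solution is $Q\subseteq\mathbb{R}^2$ such that every $(p,q)\in D$ is M-connected in $P\cup Q$; $\mathrm{opt}(P,D)$ is the minimum size of a feasible solution. *)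

theory Defs
  imports Complex_Main "HOL-Library.Landau_Symbols" "HOL-Library.Log_Nat"
    "HOL-Computational_Algebra.Polynomial"
begin

section \<open>Generalized Manhattan connections\<close>

type_synonym point = "real \<times> real"

definition l1_dist :: "point \<Rightarrow> point \<Rightarrow> real" where
  "l1_dist p q = \<bar>fst p - fst q\<bar> + \<bar>snd p - snd q\<bar>"

definition aligned :: "point \<Rightarrow> point \<Rightarrow> bool" where
  "aligned p q \<longleftrightarrow> fst p = fst q \<or> snd p = snd q"

definition M_connected :: "point set \<Rightarrow> point \<Rightarrow> point \<Rightarrow> bool" where
  "M_connected X p q \<longleftrightarrow>
    (\<exists>(k::nat) x. x 0 = p \<and> x k = q \<and> (\<forall>i\<le>k. x i \<in> X) \<and>
       (\<forall>i<k. aligned (x i) (x (Suc i))) \<and>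
       (\<Sum>i<k. l1_dist (x i) (x (Suc i))) = l1_dist p q)"

definition MinGMConn_instance :: "point set \<Rightarrow> (point \<times> point) set \<Rightarrow> bool" where
  "MinGMConn_instance P D \<longleftrightarrow>
     finite P \<and> P \<subseteq> \<int> \<times> \<int> \<and> inj_on fst P \<and> inj_on snd P \<and> D \<subseteq> P \<times> P"

definition feasible :: "point set \<Rightarrow> (point \<times> point) set \<Rightarrow> point set \<Rightarrow> bool" where
  "feasible P D Q \<longleftrightarrow> finite Q \<and> (\<forall>(p, q)\<in>D. M_connected (P \<union> Q) p q)"

definition opt :: "point set \<Rightarrow> (point \<times> point) set \<Rightarrow> nat" where
  "opt P D = (LEAST m. \<exists>Q. feasible P D Q \<and> card Q = m)"


section \<open>Algorithms and their running time\<close>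

text \<open>
  Algorithms are structured while-programs without variables. The whole store is one binary tree
  with integer leaves, and a program maps stores to stores. Integers are written in binary, and
  every elementary step is charged the bit size of the data it reads, copies and writes
  (logarithmic cost), so the time measure is polynomially related to that of Turing machines.
\<close>

datatype val = Leaf int | Node val val

fun vsize :: "val \<Rightarrow> nat" where
  "vsize (Leaf i) = 1 + floorlog 2 (nat \<bar>i\<bar>)"
| "vsize (Node a b) = 1 + vsize a + vsize b"

datatype prim = Fst | Snd | IsNode | Add | Sub | Mul | Div | Leq

fun apply_prim :: "prim \<Rightarrow> val \<Rightarrow> val" where
  "apply_prim Fst (Node a b) = a"
| "apply_prim Snd (Node a b) = b"
| "apply_prim IsNode (Node a b) = Leaf 1"
| "apply_prim Add (Node (Leaf i) (Leaf j)) = Leaf (i + j)"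
| "apply_prim Sub (Node (Leaf i) (Leaf j)) = Leaf (i - j)"
| "apply_prim Mul (Node (Leaf i) (Leaf j)) = Leaf (i * j)"
| "apply_prim Div (Node (Leaf i) (Leaf j)) = Leaf (i div j)"
| "apply_prim Leq (Node (Leaf i) (Leaf j)) = Leaf (if i \<le> j then 1 else 0)"
| "apply_prim _ _ = Leaf 0"

datatype prog =
    Skip
  | Konst val
  | Prim prim
  | Seq prog prog
  | Fork prog prog
  | Cond prog prog prog
  | While prog prog

text \<open>
  \<^term>\<open>run A x y t\<close> holds if \<^term>\<open>A\<close>, started on \<^term>\<open>x\<close>, halts with result \<^term>\<open>y\<close> after time
  \<^term>\<open>t\<close>. Tests are programs run on a copy of the store; \<^term>\<open>Leaf 0\<close> counts as false.
\<close>

inductive run :: "prog \<Rightarrow> val \<Rightarrow> val \<Rightarrow> nat \<Rightarrow> bool" where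
  run_Skip: "run Skip x x (vsize x)"
| run_Konst: "run (Konst c) x c (vsize x + vsize c)"
| run_Prim: "run (Prim f) x (apply_prim f x) (vsize x + vsize (apply_prim f x))"
| run_Seq: "run A x y s \<Longrightarrow> run B y z t \<Longrightarrow> run (Seq A B) x z (s + t + 1)"
| run_Fork: "run A x y s \<Longrightarrow> run B x z t \<Longrightarrow> run (Fork A B) x (Node y z) (vsize x + s + t + 1)"
| run_Cond_True: "run C x c s \<Longrightarrow> c \<noteq> Leaf 0 \<Longrightarrow> run A x y t
    \<Longrightarrow> run (Cond C A B) x y (vsize x + s + t + 1)"
| run_Cond_False: "run C x c s \<Longrightarrow> c = Leaf 0 \<Longrightarrow> run B x y t
    \<Longrightarrow> run (Cond C A B) x y (vsize x + s + t + 1)"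
| run_While_True: "run C x c s \<Longrightarrow> c \<noteq> Leaf 0 \<Longrightarrow> run A x y t \<Longrightarrow> run (While C A) y z u
    \<Longrightarrow> run (While C A) x z (vsize x + s + t + u + 1)"
| run_While_False: "run C x c s \<Longrightarrow> c = Leaf 0 \<Longrightarrow> run (While C A) x x (vsize x + s + 1)"

inductive_cases run_SkipE: "run Skip x y t"
inductive_cases run_KonstE: "run (Konst c) x y t"
inductive_cases run_PrimE: "run (Prim f) x y t"
inductive_cases run_SeqE: "run (Seq A B) x y t"
inductive_cases run_ForkE: "run (Fork A B) x y t"
inductive_cases run_CondE: "run (Cond C A B) x y t"
inductive_cases run_WhileE: "run (While C A) x y t"

lemma run_deterministic:
  "run A x y t \<Longrightarrow> run A x y' t' \<Longrightarrow> y' = y \<and> t' = t"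
proof (induction arbitrary: y' t' rule: run.induct)
  case run_Skip then show ?case by (auto elim: run_SkipE)
next
  case run_Konst then show ?case by (auto elim: run_KonstE)
next
  case run_Prim then show ?case by (auto elim: run_PrimE)
next
  case (run_Seq A x y s B z t)
  from run_Seq.prems show ?case by (rule run_SeqE) (auto dest!: run_Seq.IH)
next
  case (run_Fork A x y s B z t)
  from run_Fork.prems show ?case by (rule run_ForkE) (auto dest!: run_Fork.IH)
next
  case (run_Cond_True C x c s A y t B)
  from run_Cond_True.prems show ?case
    by (rule run_CondE) (use run_Cond_True.hyps(2) in \<open>auto dest!: run_Cond_True.IH\<close>)
next
  case (run_Cond_False C x c s B y t A)
  from run_Cond_False.prems show ?case
    by (rule run_CondE) (use run_Cond_False.hyps(2) in \<open>auto dest!: run_Cond_False.IH\<close>)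
next
  case (run_While_True C x c s A y t z u)
  from run_While_True.prems show ?case
    by (rule run_WhileE) (use run_While_True.hyps(2) in \<open>auto dest!: run_While_True.IH\<close>)
next
  case (run_While_False C x c s A)
  from run_While_False.prems show ?case
    by (rule run_WhileE) (use run_While_False.hyps(2) in \<open>auto dest!: run_While_False.IH\<close>)
qed

definition polynomial_time_on :: "val set \<Rightarrow> prog \<Rightarrow> bool" where
  "polynomial_time_on I A \<longleftrightarrow>
     (\<exists>T :: nat poly. \<forall>x\<in>I. \<exists>y t. run A x y t \<and> t \<le> poly T (vsize x))"

definition outputs :: "prog \<Rightarrow> val \<Rightarrow> val \<Rightarrow> bool" where
  "outputs A x y \<longleftrightarrow> (\<exists>t. run A x y t)"


section \<open>Encoding of instances and solutions\<close>

fun enc_list :: "('a \<Rightarrow> val) \<Rightarrow> 'a list \<Rightarrow> val" where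
  "enc_list e [] = Leaf 0"
| "enc_list e (x # xs) = Node (e x) (enc_list e xs)"

definition enc_pair :: "('a \<Rightarrow> val) \<Rightarrow> ('b \<Rightarrow> val) \<Rightarrow> 'a \<times> 'b \<Rightarrow> val" where
  "enc_pair e f p = Node (e (fst p)) (f (snd p))"

definition enc_rat :: "rat \<Rightarrow> val" where
  "enc_rat r = enc_pair Leaf Leaf (quotient_of r)"

definition int_point :: "int \<times> int \<Rightarrow> point" where
  "int_point = map_prod of_int of_int"

definition rat_point :: "rat \<times> rat \<Rightarrow> point" where
  "rat_point = map_prod of_rat of_rat"

text \<open>
  The input consists of repetition-free lists of the points and of the demands, in any order.
  The output is a list of points with rational coordinates.
\<close>

definition encodes_instance :: "val \<Rightarrow> point set \<Rightarrow> (point \<times> point) set \<Rightarrow> bool" where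
  "encodes_instance v P D \<longleftrightarrow>
     (\<exists>ps ds. distinct ps \<and> distinct ds \<and>
        P = int_point ` set ps \<and> D = map_prod int_point int_point ` set ds \<and>
        v = Node (enc_list (enc_pair Leaf Leaf) ps)
                 (enc_list (enc_pair (enc_pair Leaf Leaf) (enc_pair Leaf Leaf)) ds))"

definition encodes_solution :: "val \<Rightarrow> point set \<Rightarrow> bool" where
  "encodes_solution v Q \<longleftrightarrow>
     (\<exists>rs. Q = rat_point ` set rs \<and> v = enc_list (enc_pair enc_rat enc_rat) rs)"

end

theory Submission imports Defs begin

text \<open>
  Replace coordinates by ranks and let \<open>g\<close> be minimal with \<open>2\<^bsup>g\<^sup>2\<^esup> \<ge> n\<close>. Cut the \<open>x\<close>-axis
  hierarchically into slabs of \<open>2\<^bsup>gj\<^esup>\<close> consecutive ranks, \<open>j < g\<close>. Every demand has a unique level \<open>j\<close> at which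
  its endpoints lie in different slabs but in the same slab of level \<open>j + 1\<close>.

  Let an access be a slab together with a row. A demand going up from slab \<open>k\<close> to slab \<open>k'\<close> is served by a set
  of accesses if \<open>k\<close> is accessed at a row \<open>h\<close> and \<open>k'\<close> at a row \<open>h'\<close>, where \<open>h \<le> h'\<close> and both lie between the rows of
  the endpoints (for a demand going down all inequalities are reversed).
  On the one hand, every solution \<open>Q\<close> yields a serving set of at most \<open>4|Q|\<close> accesses: a path has to leave the slab
  of its first endpoint and to enter the slab of its last one along a horizontal segment between two neighbours in a row
  of \<open>P \<union> Q\<close>, such a pair of neighbours belongs to exactly one level, and one of its points is in \<open>Q\<close>.
  On the other hand, from a serving set \<open>N\<close> one gets a solution by adding, for every access, \<open>g + 2\<close> points in its row:
  the two boundaries of the slab and its ancestors in a binary search tree on the slabs of the level;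
  and, for every demand endpoint and every level, two points in the row of the endpoint.
  Since the endpoints number at most \<open>2|Q|\<close>, the cost is \<open>O(g)\<close> times the optimum as soon as
  \<open>|N|\<close> is within a constant factor of the smallest serving set.

  Such a set is found by multiplicative weights. For a guess \<open>k\<close>, take every access at which the cumulative weight
  passes a multiple of \<open>1/(4k)\<close> of the total weight. If some demand is not served, then the accesses before the first chosen one in
  its first slab and those after the last chosen one in its second slab have together less than
  \<open>1/(2k)\<close> of the weight, while every serving set contains one of them; double their weights and repeat.
  If a serving set of size \<open>k\<close> exists, this stops after polynomially many rounds.
\<close>

section \<open>Polynomial-time computable functions\<close>

class codable = fixes enc :: "'a \<Rightarrow> val"

instantiation int :: codable begin
definition enc_int :: "int \<Rightarrow> val" where "enc_int = Leaf"
instance ..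
end

instantiation bool :: codable begin
definition enc_bool :: "bool \<Rightarrow> val" where "enc_bool b = Leaf (of_bool b)"
instance ..
end

instantiation prod :: (codable, codable) codable begin
definition enc_prod :: "'a \<times> 'b \<Rightarrow> val" where "enc_prod = enc_pair enc enc"
instance ..
end

instantiation list :: (codable) codable begin
definition enc_list_inst_def: "enc (xs :: 'a list) = enc_list enc xs"
instance ..
end

lemma enc_simps [simp]:
  "enc (i :: int) = Leaf i"
  "enc b = Leaf (of_bool b)"
  "enc (x, y) = Node (enc x) (enc y)"
  "enc ([] :: 'a::codable list) = Leaf 0"
  "enc (z # zs) = Node (enc z) (enc zs)"
  by (simp_all add: enc_int_def enc_bool_def enc_prod_def enc_pair_def enc_list_inst_def)

lemma enc_prod_eq: "enc p = Node (enc (fst p)) (enc (snd p))"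
  by (simp add: enc_prod_def enc_pair_def)

abbreviation esize :: "'a::codable \<Rightarrow> nat" where "esize x \<equiv> vsize (enc x)"

lemma vsize_pos: "1 \<le> vsize v"
  by (cases v) auto

text \<open>Every rule charges for the result that it leaves, so a time bound also bounds the output
  size. This is what makes polynomial bounds compose in \<open>ptime_comp\<close>.\<close>

lemma run_vsize: "run A x y t \<Longrightarrow> vsize y \<le> t"
  by (induction rule: run.induct) auto

section \<open>Polynomial bounds and closure of the computable functions\<close>

definition poly_bounded :: "('a::codable \<Rightarrow> nat) \<Rightarrow> bool" where
  "poly_bounded b \<longleftrightarrow> (\<exists>c k. \<forall>x. b x \<le> c * esize x ^ k)"

text \<open>The program has to be right on every value of the type, not only on instances, so the
  closure rules carry no side conditions on domains.\<close>

definition ptime :: "('a::codable \<Rightarrow> 'b::codable) \<Rightarrow> bool" where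
  "ptime f \<longleftrightarrow> (\<exists>A t. poly_bounded t \<and> (\<forall>x. run A (enc x) (enc (f x)) (t x)))"

lemma poly_bounded_mono: "poly_bounded b \<Longrightarrow> (\<And>x. a x \<le> b x) \<Longrightarrow> poly_bounded a"
  unfolding poly_bounded_def by (meson order_trans)

lemma poly_bounded_const: "poly_bounded (\<lambda>_. c)"
  unfolding poly_bounded_def by (rule exI[of _ c], rule exI[of _ 0]) auto

lemma poly_bounded_self: "poly_bounded (\<lambda>x. esize x)"
  unfolding poly_bounded_def by (rule exI[of _ 1], rule exI[of _ 1]) auto

text \<open>Sizes are at least 1, so both summands are dominated by the monomial with the exponents
  added. Hence single monomials suffice as bounds.\<close>

lemma poly_bounded_add:
  assumes "poly_bounded a" "poly_bounded b" shows "poly_bounded (\<lambda>x. a x + b x)"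
proof -
  from assms obtain c k d l where a: "\<And>x. a x \<le> c * esize x ^ k" and b: "\<And>x. b x \<le> d * esize x ^ l"
    unfolding poly_bounded_def by metis
  have "a x + b x \<le> (c + d) * esize x ^ (k + l)" for x
  proof -
    have "esize x ^ k \<le> esize x ^ (k + l)" "esize x ^ l \<le> esize x ^ (k + l)"
      using vsize_pos[of "enc x"] by (auto intro!: power_increasing)
    then have "c * esize x ^ k \<le> c * esize x ^ (k + l)" "d * esize x ^ l \<le> d * esize x ^ (k + l)"
      by (auto intro: mult_left_mono)
    then show ?thesis using a[of x] b[of x] unfolding distrib_right by linarith
  qed
  then show ?thesis unfolding poly_bounded_def by blast
qed

lemma poly_bounded_mult:
  assumes "poly_bounded a" "poly_bounded b" shows "poly_bounded (\<lambda>x. a x * b x)"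
proof -
  from assms obtain c k d l where a: "\<And>x. a x \<le> c * esize x ^ k" and b: "\<And>x. b x \<le> d * esize x ^ l"
    unfolding poly_bounded_def by metis
  have "a x * b x \<le> (c * d) * esize x ^ (k + l)" for x
    using mult_mono[OF a[of x] b[of x]] by (simp add: power_add mult_ac)
  then show ?thesis unfolding poly_bounded_def by blast
qed

lemma poly_bounded_power:
  assumes "poly_bounded a" shows "poly_bounded (\<lambda>x. a x ^ k)"
  by (induction k) (auto intro!: poly_bounded_mult poly_bounded_const assms)

lemma ptime_size: assumes "ptime f" shows "poly_bounded (\<lambda>x. esize (f x))"
proof -
  from assms obtain A t where t: "poly_bounded t" "\<And>x. run A (enc x) (enc (f x)) (t x)"
    unfolding ptime_def by blast
  show ?thesis by (rule poly_bounded_mono[OF t(1)]) (rule run_vsize[OF t(2)])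
qed

lemma poly_bounded_esize_bound:
  assumes "poly_bounded b" "poly_bounded s" "\<And>x. esize (f x) \<le> s x"
  shows "poly_bounded (\<lambda>x. b (f x))"
proof -
  from assms(1) obtain c k where b: "\<And>x. b x \<le> c * esize x ^ k"
    unfolding poly_bounded_def by metis
  show ?thesis
  proof (rule poly_bounded_mono)
    show "poly_bounded (\<lambda>x. c * s x ^ k)"
      by (intro poly_bounded_mult poly_bounded_const poly_bounded_power assms)
    show "b (f x) \<le> c * s x ^ k" for x
      by (rule order_trans[OF b]) (intro mult_left_mono power_mono assms, auto)
  qed
qed

lemma poly_bounded_comp: "poly_bounded b \<Longrightarrow> ptime g \<Longrightarrow> poly_bounded (\<lambda>x. b (g x))"
  by (rule poly_bounded_esize_bound[OF _ ptime_size]) auto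

lemmas poly_bounded_intros = poly_bounded_const poly_bounded_self poly_bounded_add poly_bounded_mult

lemma ptimeI:
  assumes "\<And>x. run A (enc x) (enc (f x)) (t x)" "poly_bounded b" "\<And>x. t x \<le> b x"
  shows "ptime f"
  unfolding ptime_def using assms(1) poly_bounded_mono[OF assms(2,3)] by blast

lemma ptimeE:
  assumes "ptime f"
  obtains A t where "\<And>x. run A (enc x) (enc (f x)) (t x)" "poly_bounded t"
  using assms unfolding ptime_def by blast

named_theorems ptime_intros

lemma ptime_id [ptime_intros]: "ptime (\<lambda>x. x)"
  by (rule ptimeI[OF run_Skip poly_bounded_self]) simp

lemma ptime_const [ptime_intros]: "ptime (\<lambda>_. c)"
  by (rule ptimeI[OF run_Konst poly_bounded_add[OF poly_bounded_self poly_bounded_const[of "esize c"]]]) simp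

lemma ptime_comp:
  assumes f: "ptime f" and g: "ptime g" shows "ptime (\<lambda>x. f (g x))"
proof -
  obtain A t where A: "\<And>x. run A (enc x) (enc (f x)) (t x)" "poly_bounded t" using ptimeE[OF f] by blast
  obtain B u where B: "\<And>x. run B (enc x) (enc (g x)) (u x)" "poly_bounded u" using ptimeE[OF g] by blast
  show ?thesis
    by (rule ptimeI[OF run_Seq[OF B(1) A(1)]])
      (rule poly_bounded_add[OF poly_bounded_add[OF B(2) poly_bounded_comp[OF A(2) g]] poly_bounded_const[of 1]], simp)
qed

lemma ptime_Pair [ptime_intros]:
  assumes f: "ptime f" and g: "ptime g" shows "ptime (\<lambda>x. (f x, g x))"
proof -
  obtain A t where A: "\<And>x. run A (enc x) (enc (f x)) (t x)" "poly_bounded t" using ptimeE[OF f] by blast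
  obtain B u where B: "\<And>x. run B (enc x) (enc (g x)) (u x)" "poly_bounded u" using ptimeE[OF g] by blast
  have "run (Fork A B) (enc x) (enc (f x, g x)) (esize x + t x + u x + 1)" for x
    using run_Fork[OF A(1) B(1)] by simp
  then show ?thesis
    by (rule ptimeI)
      (rule poly_bounded_add[OF poly_bounded_add[OF poly_bounded_add[OF poly_bounded_self A(2)] B(2)] poly_bounded_const[of 1]], simp)
qed

lemma ptime_Prim:
  assumes f: "ptime f" and g: "\<And>x. enc (g x) = apply_prim r (enc (f x))"
    and s: "\<And>x. esize (g x) \<le> esize (f x) + 1"
  shows "ptime g"
proof -
  obtain A t where A: "\<And>x. run A (enc x) (enc (f x)) (t x)" "poly_bounded t" using ptimeE[OF f] by blast
  have "run (Seq A (Prim r)) (enc x) (enc (g x)) (t x + (esize (f x) + esize (g x)) + 1)" for x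
    unfolding g by (rule run_Seq[OF A(1) run_Prim])
  then show ?thesis
  proof (rule ptimeI)
    show "poly_bounded (\<lambda>x. t x + (esize (f x) + (esize (f x) + 1)) + 1)"
      by (intro poly_bounded_add A ptime_size f poly_bounded_const)
    show "t x + (esize (f x) + esize (g x)) + 1 \<le> t x + (esize (f x) + (esize (f x) + 1)) + 1" for x
      using s[of x] by simp
  qed
qed

lemma ptime_fst [ptime_intros]: "ptime f \<Longrightarrow> ptime (\<lambda>x. fst (f x))"
  by (erule ptime_Prim[where r = Fst]) (auto simp: enc_prod_eq)

lemma ptime_snd [ptime_intros]: "ptime f \<Longrightarrow> ptime (\<lambda>x. snd (f x))"
  by (erule ptime_Prim[where r = Snd]) (auto simp: enc_prod_eq)

section \<open>Bit sizes of integers\<close>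

lemma int_size_le: "\<bar>i\<bar> < 2 ^ m \<Longrightarrow> esize (i :: int) \<le> m + 1"
  by (simp add: floorlog_le_iff nat_less_iff)

lemma int_size_bound: "\<bar>i\<bar> < 2 ^ (esize (i :: int) - 1)"
proof -
  have "nat \<bar>i\<bar> < 2 ^ floorlog 2 (nat \<bar>i\<bar>)"
    using floorlog_le_iff[of 2 "nat \<bar>i\<bar>" "floorlog 2 (nat \<bar>i\<bar>)"] by simp
  then show ?thesis by (simp add: nat_less_iff)
qed

lemma int_size_mono: "\<bar>i\<bar> \<le> \<bar>j\<bar> \<Longrightarrow> esize (i :: int) \<le> esize (j :: int)"
  by (simp add: floorlog_mono nat_mono)

text \<open>A fold may only grow by an amount that depends on the new summand, and a bound by the
  sum of the sizes has that shape. It reduces to (2^a - 1) * (2^b - 1) >= 0.\<close>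

lemma esize_add: "esize (i + j :: int) \<le> esize i + esize j"
proof -
  define a where "a = esize i - 1"
  define b where "b = esize j - 1"
  have ab: "\<bar>i\<bar> < 2 ^ a" "\<bar>j\<bar> < 2 ^ b" unfolding a_def b_def by (rule int_size_bound)+
  have "0 \<le> (2 ^ a - 1) * (2 ^ b - 1 :: int)" by simp
  then have "2 ^ a + 2 ^ b \<le> 2 ^ (a + b) + (1::int)" by (simp add: algebra_simps power_add)
  with ab have "\<bar>i + j\<bar> < 2 ^ (a + b)" by linarith
  from int_size_le[OF this] show ?thesis
    using vsize_pos[of "enc i"] vsize_pos[of "enc j"] unfolding a_def b_def by linarith
qed

lemma esize_mult: "esize (i * j :: int) \<le> esize i + esize j"
proof -
  define a where "a = esize i - 1"
  define b where "b = esize j - 1"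
  have ab: "\<bar>i\<bar> < 2 ^ a" "\<bar>j\<bar> < 2 ^ b" unfolding a_def b_def by (rule int_size_bound)+
  have "\<bar>i * j\<bar> < 2 ^ (a + b)" unfolding abs_mult power_add
    by (rule mult_strict_mono'[OF ab]) auto
  from int_size_le[OF this] show ?thesis
    using vsize_pos[of "enc i"] vsize_pos[of "enc j"] unfolding a_def b_def by linarith
qed

lemma abs_div_le: "\<bar>i div j\<bar> \<le> \<bar>i :: int\<bar>"
proof -
  have *: "\<bar>i div j\<bar> \<le> \<bar>i\<bar>" if "1 \<le> j" for i j :: int
  proof (cases "0 \<le> i")
    case True
    with zdiv_mono2[of i 1 j] that show ?thesis by (simp add: pos_imp_zdiv_nonneg_iff)
  next
    case False
    then have "i div j < 0" using that by (simp add: pos_imp_zdiv_neg_iff)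
    with zdiv_mono2_neg[of i 1 j] that False show ?thesis by simp
  qed
  \<comment> \<open>Division by zero yields zero; a negative divisor is made positive by negating
    both operands.\<close>
  consider "j = 0" | "1 \<le> j" | "1 \<le> - j" by linarith
  then show ?thesis
  proof cases
    case 3 with *[of "- j" "- i"] show ?thesis by simp
  qed (use * in auto)
qed

lemma esize_div: "esize (i div j :: int) \<le> esize i"
  by (rule int_size_mono[OF abs_div_le])

lemma ptime_int_op:
  assumes "ptime f" "ptime g"
    and "\<And>i j. apply_prim r (Node (Leaf i) (Leaf j)) = enc (h i j)"
    and "\<And>i j. esize (h i j) \<le> esize i + esize j"
  shows "ptime (\<lambda>x. h (f x) (g x))"
proof (rule ptime_Prim[OF ptime_Pair[OF assms(1,2)], where r = r])
  show "esize (h (f x) (g x)) \<le> esize (f x, g x) + 1" for x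
    using assms(4)[of "f x" "g x"] by simp
qed (simp add: assms(3))

lemma ptime_plus [ptime_intros]: "ptime f \<Longrightarrow> ptime g \<Longrightarrow> ptime (\<lambda>x. f x + g x :: int)"
  by (rule ptime_int_op[where r = Add], assumption, assumption, simp, rule esize_add)

lemma ptime_minus [ptime_intros]: "ptime f \<Longrightarrow> ptime g \<Longrightarrow> ptime (\<lambda>x. f x - g x :: int)"
  by (rule ptime_int_op[where r = Sub], assumption, assumption, simp)
    (use esize_add[of _ "- j" for j] in simp)

lemma ptime_times [ptime_intros]: "ptime f \<Longrightarrow> ptime g \<Longrightarrow> ptime (\<lambda>x. f x * g x :: int)"
  by (rule ptime_int_op[where r = Mul], assumption, assumption, simp, rule esize_mult)

lemma ptime_div [ptime_intros]: "ptime f \<Longrightarrow> ptime g \<Longrightarrow> ptime (\<lambda>x. f x div g x :: int)"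
  by (rule ptime_int_op[where r = Div], assumption, assumption, simp, rule trans_le_add1[OF esize_div])

lemma ptime_le [ptime_intros]: "ptime f \<Longrightarrow> ptime g \<Longrightarrow> ptime (\<lambda>x. f x \<le> (g x :: int))"
  by (rule ptime_int_op[where r = Leq], assumption, assumption) (auto simp: floorlog_def)

lemma ptime_if [ptime_intros]:
  assumes "ptime P" "ptime f" "ptime g" shows "ptime (\<lambda>x. if P x then f x else g x)"
proof -
  obtain A t where A: "\<And>x. run A (enc x) (enc (f x)) (t x)" "poly_bounded t" using ptimeE[OF assms(2)] by blast
  obtain B u where B: "\<And>x. run B (enc x) (enc (g x)) (u x)" "poly_bounded u" using ptimeE[OF assms(3)] by blast
  obtain C s where C: "\<And>x. run C (enc x) (enc (P x)) (s x)" "poly_bounded s" using ptimeE[OF assms(1)] by blast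
  have "run (Cond C A B) (enc x) (enc (if P x then f x else g x))
      (esize x + s x + (if P x then t x else u x) + 1)" for x
    using run_Cond_True[OF C(1) _ A(1), of x B] run_Cond_False[OF C(1) _ B(1), of x A] by auto
  then show ?thesis
  proof (rule ptimeI)
    show "poly_bounded (\<lambda>x. esize x + s x + (t x + u x) + 1)"
      by (intro poly_bounded_add poly_bounded_self poly_bounded_const A B C)
  qed simp
qed

lemma ptime_Not [ptime_intros]:
  assumes "ptime P" shows "ptime (\<lambda>x. \<not> P x)"
proof -
  have "(\<lambda>x. \<not> P x) = (\<lambda>x. if P x then False else True)" by auto
  then show ?thesis by (simp only: ptime_if[OF assms ptime_const ptime_const])
qed

lemma ptime_conj [ptime_intros]:
  assumes "ptime P" "ptime Q" shows "ptime (\<lambda>x. P x \<and> Q x)"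
proof -
  have "(\<lambda>x. P x \<and> Q x) = (\<lambda>x. if P x then Q x else False)" by auto
  then show ?thesis by (simp only: ptime_if[OF assms ptime_const])
qed

lemma ptime_less [ptime_intros]:
  assumes "ptime f" "ptime g" shows "ptime (\<lambda>x. f x < (g x :: int))"
  using ptime_Not[OF ptime_le[OF assms(2,1)]] by (simp add: not_le)

lemma ptime_eq [ptime_intros]:
  assumes "ptime f" "ptime g" shows "ptime (\<lambda>x. f x = (g x :: int))"
  using ptime_conj[OF ptime_le[OF assms] ptime_le[OF assms(2,1)]] by (simp add: eq_iff)

lemma ptime_is_Cons [ptime_intros]: "ptime f \<Longrightarrow> ptime (\<lambda>x. f x \<noteq> [])"
proof (erule ptime_Prim[where r = IsNode])
  show "enc (f x \<noteq> []) = apply_prim IsNode (enc (f x))" for x :: 'a and f :: "'a \<Rightarrow> 'b list"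
    by (cases "f x") auto
  show "esize (f x \<noteq> []) \<le> esize (f x) + 1" for x :: 'a and f :: "'a \<Rightarrow> 'b list"
    by (cases "f x") (auto simp: floorlog_def)
qed

lemma ptime_Cons [ptime_intros]:
  assumes "ptime f" "ptime g" shows "ptime (\<lambda>x. f x # g x)"
proof -
  have "ptime (\<lambda>x. (f x, g x))" by (intro ptime_Pair assms)
  then show ?thesis unfolding ptime_def by simp
qed

text \<open>A nonempty list is encoded exactly as the pair of its head and tail, so after the test
  the pair of \<open>x\<close> and \<open>L x\<close> is already an argument for the program of the
  second branch.\<close>

lemma ptime_case_list [ptime_intros]:
  assumes L: "ptime L" and f: "ptime f" and g: "ptime (\<lambda>z. g (fst z) (fst (snd z)) (snd (snd z)))"
  shows "ptime (\<lambda>x. case L x of [] \<Rightarrow> f x | y # ys \<Rightarrow> g x y ys)"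
proof -
  obtain A t where A: "\<And>x. run A (enc x) (enc (f x)) (t x)" "poly_bounded t" using ptimeE[OF f] by blast
  obtain B u where B: "\<And>z. run B (enc z) (enc (g (fst z) (fst (snd z)) (snd (snd z)))) (u z)" "poly_bounded u"
    using ptimeE[OF g] by blast
  obtain C s where C: "\<And>x. run C (enc x) (enc (L x \<noteq> [])) (s x)" "poly_bounded s"
    using ptimeE[OF ptime_is_Cons[OF L]] by blast
  obtain E v where E: "\<And>x. run E (enc x) (enc (x, L x)) (v x)" "poly_bounded v"
    using ptimeE[OF ptime_Pair[OF ptime_id L]] by blast
  define u' where "u' x = (case L x of [] \<Rightarrow> 0 | y # ys \<Rightarrow> u (x, y, ys))" for x
  have u': "poly_bounded u'"
  proof -
    obtain c k where u: "\<And>z. u z \<le> c * esize z ^ k"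
      using B(2) unfolding poly_bounded_def by blast
    show ?thesis
    proof (rule poly_bounded_mono)
      show "poly_bounded (\<lambda>x. c * (1 + esize x + esize (L x)) ^ k)"
        by (intro poly_bounded_mult poly_bounded_power poly_bounded_add poly_bounded_const
            poly_bounded_self ptime_size L)
      show "u' x \<le> c * (1 + esize x + esize (L x)) ^ k" for x
        using u[of "(x, hd (L x), tl (L x))"] by (cases "L x") (simp_all add: u'_def)
    qed
  qed
  have "run (Cond C (Seq E B) A) (enc x) (enc (case L x of [] \<Rightarrow> f x | y # ys \<Rightarrow> g x y ys))
      (esize x + s x + (if L x = [] then t x else v x + u' x + 1) + 1)" for x
  proof (cases "L x")
    case Nil
    then show ?thesis using run_Cond_False[OF C(1) _ A(1), of x "Seq E B"] by auto
  next
    case (Cons y ys)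
    have "run B (enc (x, L x)) (enc (g x y ys)) (u' x)"
      using B(1)[of "(x, y, ys)"] Cons by (simp add: u'_def)
    from run_Cond_True[OF C(1) _ run_Seq[OF E(1) this], of A] Cons show ?thesis by simp
  qed
  then show ?thesis
  proof (rule ptimeI)
    show "poly_bounded (\<lambda>x. esize x + s x + (t x + (v x + u' x + 1)) + 1)"
      by (intro poly_bounded_add poly_bounded_self poly_bounded_const A B C E u')
  qed simp
qed

section \<open>Loops\<close>

lemma run_While_iterate:
  fixes H :: "'a::codable \<Rightarrow> 'a"
  assumes "\<And>x. run C (enc x) (enc (P x)) (s x)" "\<And>x. run A (enc x) (enc (H x)) (t x)"
    and "\<And>i. i < n \<Longrightarrow> P ((H ^^ i) x)" "\<not> P ((H ^^ n) x)"
    and "\<And>i. i \<le> n \<Longrightarrow> esize ((H ^^ i) x) + s ((H ^^ i) x) + t ((H ^^ i) x) + 1 \<le> U"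
  shows "\<exists>T \<le> (n + 1) * U. run (While C A) (enc x) (enc ((H ^^ n) x)) T"
  using assms(3-)
proof (induction n arbitrary: x)
  case 0
  have "run (While C A) (enc x) (enc x) (esize x + s x + 1)"
    using 0(2) by (intro run_While_False[OF assms(1)]) simp
  moreover have "esize x + s x + 1 \<le> (0 + 1) * U" using 0(3)[of 0] by simp
  ultimately show ?case unfolding funpow_0 by blast
next
  case (Suc n)
  have "\<exists>T \<le> (n + 1) * U. run (While C A) (enc (H x)) (enc ((H ^^ n) (H x))) T"
  proof (rule Suc.IH)
    show "P ((H ^^ i) (H x))" if "i < n" for i
      using Suc.prems(1)[of "Suc i"] that by (simp add: funpow_swap1)
    show "\<not> P ((H ^^ n) (H x))" using Suc.prems(2) by (simp add: funpow_swap1)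
    show "esize ((H ^^ i) (H x)) + s ((H ^^ i) (H x)) + t ((H ^^ i) (H x)) + 1 \<le> U" if "i \<le> n" for i
      using Suc.prems(3)[of "Suc i"] that by (simp add: funpow_swap1)
  qed
  then obtain T where T: "T \<le> (n + 1) * U" "run (While C A) (enc (H x)) (enc ((H ^^ n) (H x))) T" by blast
  have "run (While C A) (enc x) (enc ((H ^^ Suc n) x)) (esize x + s x + t x + T + 1)"
    using run_While_True[OF assms(1) _ assms(2) T(2)] Suc.prems(1)[of 0] by (simp add: funpow_swap1)
  moreover have "esize x + s x + t x + T + 1 \<le> (Suc n + 1) * U"
    using Suc.prems(3)[of 0] T(1) by simp
  ultimately show ?case by blast
qed

text \<open>Repeated squaring shows that polynomially many rounds may produce exponentially large
  states. Hence the sizes of all intermediate states are bounded as well.\<close>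

lemma ptime_while:
  fixes H :: "'a::codable \<Rightarrow> 'a"
  assumes P: "ptime P" and H: "ptime H" and n: "poly_bounded n" and b: "poly_bounded b"
    and "\<And>x i. i < n x \<Longrightarrow> P ((H ^^ i) x)" "\<And>x. \<not> P ((H ^^ n x) x)"
    and size: "\<And>x i. i \<le> n x \<Longrightarrow> esize ((H ^^ i) x) \<le> b x"
  shows "ptime (\<lambda>x. (H ^^ n x) x)"
proof -
  obtain A t where A: "\<And>x. run A (enc x) (enc (H x)) (t x)" "poly_bounded t" using ptimeE[OF H] by blast
  obtain C s where C: "\<And>x. run C (enc x) (enc (P x)) (s x)" "poly_bounded s" using ptimeE[OF P] by blast
  have "poly_bounded (\<lambda>x. esize x + s x + t x + 1)"
    by (intro poly_bounded_add poly_bounded_self poly_bounded_const A C)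
  then obtain c k where ck: "\<And>x. esize x + s x + t x + 1 \<le> c * esize x ^ k"
    unfolding poly_bounded_def by blast
  have "\<exists>T \<le> (n x + 1) * (c * b x ^ k). run (While C A) (enc x) (enc ((H ^^ n x) x)) T" for x
  proof (rule run_While_iterate[OF C(1) A(1) assms(5,6)])
    show "esize ((H ^^ i) x) + s ((H ^^ i) x) + t ((H ^^ i) x) + 1 \<le> c * b x ^ k" if "i \<le> n x" for i
      by (rule order_trans[OF ck mult_le_mono2[OF power_mono[OF size[OF that]]]]) simp
  qed
  then obtain T where T: "\<And>x. T x \<le> (n x + 1) * (c * b x ^ k)"
    "\<And>x. run (While C A) (enc x) (enc ((H ^^ n x) x)) (T x)" by metis
  show ?thesis
    by (rule ptimeI[OF T(2) _ T(1)])
      (intro poly_bounded_add poly_bounded_mult poly_bounded_power poly_bounded_const n b)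
qed

section \<open>Folds and operations on lists\<close>

lemma esize_mem: "y \<in> set l \<Longrightarrow> esize y \<le> esize l"
  by (induction l) auto

lemma length_le_esize: "length l \<le> esize l"
  by (induction l) auto

lemma esize_drop: "esize (drop i l) \<le> esize l"
  by (induction l arbitrary: i) (auto simp: drop_Cons' intro: le_SucI trans_le_add2)

lemma esize_append: "esize (xs @ ys) \<le> esize xs + esize ys"
  by (induction xs) auto

lemma esize_filter: "esize (filter P xs) \<le> esize xs"
  by (induction xs) auto

lemma foldl_size:
  assumes "\<And>s y. y \<in> set l \<Longrightarrow> esize (f s y) \<le> esize s + Q"
  shows "esize (foldl f s l) \<le> esize s + length l * Q"
  using assms
proof (induction l arbitrary: s)
  case (Cons y l)
  have "esize (foldl f (f s y) l) \<le> esize (f s y) + length l * Q" using Cons by simp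
  also have "\<dots> \<le> esize s + Q + length l * Q" using Cons.prems[of y s] by simp
  finally show ?case by simp
qed simp

text \<open>
  The growth condition is additive, so that the accumulator stays polynomially bounded over polynomially many steps.
\<close>

lemma ptime_foldl:
  fixes f :: "'x::codable \<Rightarrow> 's::codable \<Rightarrow> 'y::codable \<Rightarrow> 's"
  assumes f: "ptime (\<lambda>z. f (fst z) (fst (snd z)) (snd (snd z)))"
    and q: "poly_bounded q" and growth: "\<And>x s y. esize (f x s y) \<le> esize s + q (x, y)"
    and S: "ptime S" and L: "ptime L"
  shows "ptime (\<lambda>x. foldl (f x) (S x) (L x))"
proof -
  \<comment> \<open>A loop state holds the rest of the list, the parameter and the
    accumulator.\<close>
  define H where "H z = (case fst z of [] \<Rightarrow> z | y # ys \<Rightarrow>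
    (ys, fst (snd z), f (fst (snd z)) (snd (snd z)) y))" for z
  have H: "ptime H" unfolding H_def
    by (intro ptime_intros ptime_comp[OF f, of "\<lambda>x. (a x, b x, c x)" for a b c, unfolded fst_conv snd_conv])
  have it: "(H ^^ i) (l, x, s) = (drop i l, x, foldl (f x) s (take i l))" for i l x s
  proof (induction i arbitrary: l s)
    case (Suc i)
    have "(H ^^ Suc i) (l, x, s) = (H ^^ i) (H (l, x, s))" by (simp add: funpow_swap1)
    also have "\<dots> = (drop (Suc i) l, x, foldl (f x) s (take (Suc i) l))"
      by (cases l) (simp_all add: H_def Suc)
    finally show ?case .
  qed simp
  obtain c k where ck: "\<And>z. q z \<le> c * esize z ^ k" using q unfolding poly_bounded_def by blast
  have "ptime (\<lambda>z. (H ^^ length (fst z)) z)"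
  proof (rule ptime_while[where P = "\<lambda>z. fst z \<noteq> []" and b = "\<lambda>z. esize z + esize z * (c * esize z ^ k)"])
    show "ptime (\<lambda>z. fst z \<noteq> [])" by (intro ptime_intros)
    show "poly_bounded (\<lambda>z. length (fst z))"
      by (rule poly_bounded_mono[OF ptime_size[OF ptime_fst[OF ptime_id]]]) (rule length_le_esize)
    show "poly_bounded (\<lambda>z. esize z + esize z * (c * esize z ^ k))"
      by (intro poly_bounded_intros poly_bounded_power)
    show "fst ((H ^^ i) z) \<noteq> []" if "i < length (fst z)" for i z
      using that by (cases z) (auto simp: it)
    show "\<not> fst ((H ^^ length (fst z)) z) \<noteq> []" for z
      by (cases z) (auto simp: it)
    show "esize ((H ^^ i) z) \<le> esize z + esize z * (c * esize z ^ k)" if "i \<le> length (fst z)" for i z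
    proof -
      obtain l x s where z: "z = (l, x, s)" by (cases z) auto
      define Q where "Q = c * esize z ^ k"
      have "esize (foldl (f x) s (take i l)) \<le> esize s + length (take i l) * Q"
      proof (rule foldl_size)
        fix s y assume "y \<in> set (take i l)"
        then have "esize y \<le> esize l" by (intro esize_mem) (auto dest: in_set_takeD)
        then have "esize (x, y) \<le> esize z" by (simp add: z)
        then have "q (x, y) \<le> Q" unfolding Q_def
          by (intro order_trans[OF ck] mult_le_mono2 power_mono) auto
        then show "esize (f x s y) \<le> esize s + Q" using growth[of x s y] by simp
      qed
      moreover have "length (take i l) * Q \<le> esize z * Q"
        using length_le_esize[of l] by (intro mult_le_mono1) (simp add: z)
      ultimately have "esize (foldl (f x) s (take i l)) \<le> esize s + esize z * Q" by linarith
      then show ?thesis using esize_drop[of i l] unfolding z it Q_def by simp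
    qed
  qed (rule H)
  from ptime_comp[OF ptime_snd[OF ptime_snd[OF this]] ptime_Pair[OF L ptime_Pair[OF ptime_id S]]]
  show ?thesis by (simp add: it)
qed

text \<open>The number of rounds is given in unary, as the length of a list whose entries are
  ignored.\<close>

lemma ptime_funpow:
  fixes f :: "'x::codable \<Rightarrow> 's::codable \<Rightarrow> 's" and L :: "'x \<Rightarrow> 'y::codable list"
  assumes f: "ptime (\<lambda>z. f (fst z) (snd z))"
    and q: "poly_bounded q" and growth: "\<And>x s. esize (f x s) \<le> esize s + q x"
    and S: "ptime S" and L: "ptime L"
  shows "ptime (\<lambda>x. (f x ^^ length (L x)) (S x))"
proof -
  have eq: "foldl (\<lambda>s _. g s) s l = (g ^^ length l) s" for g :: "'s \<Rightarrow> 's" and s and l :: "'y list"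
    by (induction l arbitrary: s) (auto simp: funpow_swap1)
  have "ptime (\<lambda>x. foldl (\<lambda>s _. f x s) (S x) (L x))"
  proof (rule ptime_foldl[OF _ _ _ S L])
    show "ptime (\<lambda>z :: 'x \<times> 's \<times> 'y. f (fst z) (fst (snd z)))"
      using ptime_comp[OF f, of "\<lambda>z :: 'x \<times> 's \<times> 'y. (fst z, fst (snd z))"] by (simp add: ptime_intros)
    show "poly_bounded (\<lambda>z :: 'x \<times> 'y. q (fst z))"
      by (rule poly_bounded_comp[OF q]) (intro ptime_intros)
    show "esize (f x s) \<le> esize s + q (fst (x, y))" for x s and y :: 'y
      using growth by simp
  qed
  then show ?thesis unfolding eq .
qed

text \<open>Turns a rule about an uncurried function into an introduction rule for calls inside
  larger terms, so that \<open>ptime_intros\<close> can follow the syntax of a definition.\<close>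

lemma ptime_lift2:
  assumes "ptime (\<lambda>z. f (fst z) (snd z))" "ptime a" "ptime b" shows "ptime (\<lambda>x. f (a x) (b x))"
  using ptime_comp[OF assms(1) ptime_Pair[OF assms(2,3)]] by simp

text \<open>A left fold that conses reverses its list, so this operation is obtained directly.
  Append, map and filter need one more reversal.\<close>

lemma ptime_rev_append: "ptime f \<Longrightarrow> ptime g \<Longrightarrow> ptime (\<lambda>x. rev (f x) @ g x)"
proof -
  assume *: "ptime f" "ptime g"
  have eq: "foldl (\<lambda>s y. y # s) t l = rev l @ t" for l t :: "'b list"
    by (induction l arbitrary: t) auto
  have "ptime (\<lambda>x. foldl (\<lambda>s y. y # s) (g x) (f x))"
    by (rule ptime_foldl[OF _ poly_bounded_add[OF poly_bounded_const[of 1] poly_bounded_self] _ *(2,1)])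
      (intro ptime_intros, simp)
  then show ?thesis unfolding eq .
qed

lemma ptime_rev: "ptime f \<Longrightarrow> ptime (\<lambda>x. rev (f x))"
  using ptime_rev_append[OF _ ptime_const[of "[]"]] by auto

lemma ptime_append [ptime_intros]: "ptime f \<Longrightarrow> ptime g \<Longrightarrow> ptime (\<lambda>x. f x @ g x)"
  using ptime_rev_append[OF ptime_rev] by auto

lemma ptime_map [ptime_intros]:
  assumes L: "ptime L" and f: "ptime (\<lambda>z. f (fst z) (snd z))" shows "ptime (\<lambda>x. map (f x) (L x))"
proof -
  have eq: "foldl (\<lambda>s y. g y # s) t l = rev (map g l) @ t" for g t l
    by (induction l arbitrary: t) auto
  have "ptime (\<lambda>x. foldl (\<lambda>s y. f x y # s) [] (L x))"
  proof (rule ptime_foldl[OF _ _ _ ptime_const L])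
    show "poly_bounded (\<lambda>z. 1 + esize (f (fst z) (snd z)))"
      by (intro poly_bounded_add poly_bounded_const ptime_size f)
  qed (intro ptime_intros ptime_lift2[OF f], simp)
  from ptime_rev[OF this] show ?thesis unfolding eq by simp
qed

lemma ptime_filter [ptime_intros]:
  assumes L: "ptime L" and P: "ptime (\<lambda>z. P (fst z) (snd z))" shows "ptime (\<lambda>x. filter (P x) (L x))"
proof -
  have eq: "foldl (\<lambda>s y. if Q y then y # s else s) t l = rev (filter Q l) @ t" for Q t l
    by (induction l arbitrary: t) auto
  have "ptime (\<lambda>x. foldl (\<lambda>s y. if P x y then y # s else s) [] (L x))"
    by (rule ptime_foldl[OF _ poly_bounded_add[OF poly_bounded_const[of 1] poly_bounded_self] _ ptime_const L])
     (intro ptime_intros ptime_lift2[OF P], simp)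
  from ptime_rev[OF this] show ?thesis unfolding eq by simp
qed

lemma ptime_concat [ptime_intros]:
  assumes "ptime L" shows "ptime (\<lambda>x. concat (L x))"
proof -
  have eq: "foldl (@) t l = t @ concat l" for t and l :: "'b list list"
    by (induction l arbitrary: t) auto
  have "ptime (\<lambda>x. foldl (@) [] (L x))"
    by (rule ptime_foldl[where f = "\<lambda>_. (@)", OF _ poly_bounded_self _ ptime_const assms])
     (intro ptime_intros, rule order_trans[OF esize_append], simp)
  then show ?thesis unfolding eq by simp
qed

lemma ptime_sum_list [ptime_intros]:
  assumes "ptime L" shows "ptime (\<lambda>x. sum_list (L x) :: int)"
proof -
  have eq: "foldl (+) t l = t + sum_list l" for t and l :: "int list"
    by (induction l arbitrary: t) auto
  have "ptime (\<lambda>x. foldl (+) (0::int) (L x))"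
    by (rule ptime_foldl[where f = "\<lambda>_. (+)", OF _ poly_bounded_self _ ptime_const assms])
     (intro ptime_intros, rule order_trans[OF esize_add], simp)
  then show ?thesis unfolding eq by simp
qed

lemma ptime_power [ptime_intros]:
  assumes b: "ptime b" and L: "ptime L" shows "ptime (\<lambda>x. (b x :: int) ^ length (L x))"
proof -
  have eq: "((*) c ^^ m) 1 = c ^ m" for c :: int and m
    by (induction m) auto
  have "ptime (\<lambda>x. ((*) (b x) ^^ length (L x)) 1)"
  proof (rule ptime_funpow[OF _ ptime_size[OF b] _ ptime_const L])
    show "ptime (\<lambda>z. b (fst z) * snd z)" by (intro ptime_intros ptime_comp[OF b])
    show "esize (b x * s) \<le> esize s + esize (b x)" for x s
      using esize_mult[of "b x" s] by simp
  qed
  then show ?thesis unfolding eq .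
qed

lemma ptime_length [ptime_intros]:
  assumes L: "ptime L" shows "ptime (\<lambda>x. int (length (L x)))"
proof -
  have "ptime (\<lambda>x. sum_list (map (\<lambda>_. 1 :: int) (L x)))" by (intro ptime_intros L)
  then show ?thesis by (simp add: sum_list_triv)
qed

lemma ptime_Bex [ptime_intros]:
  assumes "ptime L" "ptime (\<lambda>z. P (fst z) (snd z))" shows "ptime (\<lambda>x. \<exists>y \<in> set (L x). P x y)"
proof -
  have "(\<lambda>x. \<exists>y \<in> set (L x). P x y) = (\<lambda>x. filter (P x) (L x) \<noteq> [])"
    by (auto simp: filter_empty_conv)
  then show ?thesis by (simp only: ptime_is_Cons[OF ptime_filter[OF assms]])
qed

lemma ptime_Ball [ptime_intros]:
  assumes "ptime L" "ptime (\<lambda>z. P (fst z) (snd z))" shows "ptime (\<lambda>x. \<forall>y \<in> set (L x). P x y)"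
  using ptime_Not[OF ptime_Bex[OF assms(1) ptime_Not[OF assms(2)]]] by simp

lemma ptime_mem [ptime_intros]:
  assumes "ptime f" "ptime L" shows "ptime (\<lambda>x. (f x :: int) \<in> set (L x))"
proof -
  have "ptime (\<lambda>x. \<exists>y \<in> set (L x). f x = y)"
    by (intro ptime_intros assms ptime_comp[OF assms(1)])
  then show ?thesis by simp
qed

lemma ptime_disj [ptime_intros]:
  assumes "ptime P" "ptime Q" shows "ptime (\<lambda>x. P x \<or> Q x)"
  using ptime_Not[OF ptime_conj[OF ptime_Not[OF assms(1)] ptime_Not[OF assms(2)]]] by simp

section \<open>Multiplicative weights\<close>

text \<open>
  Accesses are coded as integers such that the accesses of one slab are consecutive. The weights are not stored:
  \<open>H\<close> is the list of the sets that have been doubled so far.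
\<close>

definition weight :: "int list list \<Rightarrow> int \<Rightarrow> int" where
  "weight H e = 2 ^ length (filter (\<lambda>F. e \<in> set F) H)"

definition total_weight :: "int list list \<Rightarrow> int list \<Rightarrow> int" where
  "total_weight H es = sum_list (map (weight H) es)"

definition cumul :: "int list list \<Rightarrow> int list \<Rightarrow> int \<Rightarrow> int" where
  "cumul H es e = total_weight H (filter (\<lambda>f. f \<le> e) es)"

definition quantile :: "int \<Rightarrow> int list list \<Rightarrow> int list \<Rightarrow> int \<Rightarrow> int" where
  "quantile k H es e = (4 * k * cumul H es e) div total_weight H es"

definition net :: "int \<Rightarrow> int list list \<Rightarrow> int list \<Rightarrow> int list" where
  "net k H es = filter (\<lambda>e. quantile k H es (e - 1) < quantile k H es e) es"

text \<open>
  A demand is coded as \<open>(s, p, q, c, d)\<close>: the accesses of its two slabs are \<open>p + h\<close> and \<open>q + h\<close> for the rows \<open>h\<close>,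
  its endpoints are in the rows \<open>c\<close> and \<open>d\<close>, and the sign \<open>s\<close> is \<open>1\<close> if it goes up and \<open>-1\<close> if it goes down.
\<close>

type_synonym pair_demand = "int \<times> int \<times> int \<times> int \<times> int"

definition served :: "int set \<Rightarrow> pair_demand \<Rightarrow> bool" where
  "served N = (\<lambda>(s, p, q, c, d). \<exists>e \<in> N. \<exists>f \<in> N.
     s * c \<le> s * (e - p) \<and> s * (e - p) \<le> s * (f - q) \<and> s * (f - q) \<le> s * d)"

text \<open>These are the accesses of the first slab that the demand could use but that come before
  the first usable element of \<open>N\<close>; \<open>end_gap\<close> mirrors this after the last
  usable element in the second slab. Both are intervals of codes that avoid \<open>N\<close>, which
  bounds their weight.\<close>

definition start_gap :: "int set \<Rightarrow> pair_demand \<Rightarrow> int \<Rightarrow> bool" where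
  "start_gap N = (\<lambda>(s, p, q, c, d) e. s * c \<le> s * (e - p) \<and> s * (e - p) \<le> s * d \<and>
     (\<forall>f \<in> N. \<not> (s * c \<le> s * (f - p) \<and> s * (f - p) \<le> s * (e - p))))"

definition end_gap :: "int set \<Rightarrow> pair_demand \<Rightarrow> int \<Rightarrow> bool" where
  "end_gap N = (\<lambda>(s, p, q, c, d) e. s * c \<le> s * (e - q) \<and> s * (e - q) \<le> s * d \<and>
     (\<forall>f \<in> N. \<not> (s * (e - q) \<le> s * (f - q) \<and> s * (f - q) \<le> s * d)))"

definition gap :: "int list \<Rightarrow> pair_demand \<Rightarrow> int list \<Rightarrow> int list" where
  "gap N d es = filter (\<lambda>e. start_gap (set N) d e \<or> end_gap (set N) d e) es"

text \<open>Histories at which all demands are served are fixed points, so a fixed number of rounds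
  can be run without a stopping test.\<close>

definition reweight :: "int list \<Rightarrow> pair_demand list \<Rightarrow> int \<Rightarrow> int list list \<Rightarrow> int list list" where
  "reweight es ds k H = (case filter (\<lambda>d. \<not> served (set (net k H es)) d) ds of
     [] \<Rightarrow> H | d # _ \<Rightarrow> gap (net k H es) d es # H)"

text \<open>Only the length matters: five times the square of the number of accesses, enough for
  \<open>rounds_enough\<close> with any guess up to that number.\<close>

definition rounds :: "int list \<Rightarrow> int list" where
  "rounds es = concat (map (\<lambda>_. es @ es @ es @ es @ es) es)"

definition final_net :: "int list \<Rightarrow> pair_demand list \<Rightarrow> int \<Rightarrow> int list" where
  "final_net es ds k = net k ((reweight es ds k ^^ length (rounds es)) []) es"

lemma weight_pos: "0 < weight H e"
  by (simp add: weight_def)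

lemma total_nonneg: "0 \<le> total_weight H es"
  unfolding total_weight_def by (intro sum_list_nonneg) (auto simp: weight_pos less_imp_le)

lemma total_Cons: "total_weight H (e # es) = weight H e + total_weight H es"
  by (simp add: total_weight_def)

lemma total_Nil: "total_weight H [] = 0"
  by (simp add: total_weight_def)

lemma total_filter_mono:
  "(\<And>e. e \<in> set es \<Longrightarrow> P e \<Longrightarrow> Q e) \<Longrightarrow> total_weight H (filter P es) \<le> total_weight H (filter Q es)"
  by (induction es) (auto simp: total_Cons total_Nil intro: add_increasing less_imp_le[OF weight_pos])

lemma total_filter_disj:
  "total_weight H (filter (\<lambda>e. P e \<or> Q e) es) \<le> total_weight H (filter P es) + total_weight H (filter Q es)"
proof (induction es)
  case (Cons e es)
  then show ?case using weight_pos[of H e] by (auto simp: total_Cons)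
qed (simp add: total_Nil)

lemma weight_le_total: "e \<in> set es \<Longrightarrow> weight H e \<le> total_weight H es"
  using total_nonneg[of H] weight_pos[of H]
  by (induction es) (auto simp: total_Cons intro: add_increasing add_increasing2 less_imp_le)

lemma cumul_mono: "e \<le> f \<Longrightarrow> cumul H es e \<le> cumul H es f"
  unfolding cumul_def by (rule total_filter_mono) simp

lemma quantile_mono:
  assumes "0 \<le> k" "e \<le> f" shows "quantile k H es e \<le> quantile k H es f"
proof (cases "total_weight H es = 0")
  case False
  then have "0 < total_weight H es" using total_nonneg[of H es] by simp
  then show ?thesis unfolding quantile_def
    using assms by (intro zdiv_mono1 mult_left_mono cumul_mono) auto
qed (simp add: quantile_def)

text \<open>A chosen access raises the quantile above its value at all smaller codes. So chosen
  accesses have distinct quantiles, and these lie between 1 and 4k.\<close>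

lemma card_net:
  assumes k: "0 \<le> k" shows "int (card (set (net k H es))) \<le> 4 * k"
proof (cases "total_weight H es = 0")
  case True
  then show ?thesis using k by (simp add: net_def quantile_def)
next
  case False
  then have W: "0 < total_weight H es" using total_nonneg[of H es] by simp
  have "inj_on (quantile k H es) (set (net k H es))"
  proof (rule linorder_inj_onI)
    fix e f assume *: "e < f" "f \<in> set (net k H es)"
    then have "quantile k H es e \<le> quantile k H es (f - 1)" by (intro quantile_mono k) simp
    also have "\<dots> < quantile k H es f" using * by (simp add: net_def)
    finally show "quantile k H es e \<noteq> quantile k H es f" by simp
  qed auto
  moreover have "quantile k H es ` set (net k H es) \<subseteq> {0<..4 * k}"
  proof safe
    fix e assume e: "e \<in> set (net k H es)"
    have "0 \<le> quantile k H es (e - 1)" unfolding quantile_def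
      using W k by (simp add: pos_imp_zdiv_nonneg_iff cumul_def total_nonneg)
    then show "quantile k H es e \<in> {0<..4 * k}"
    proof -
      have "cumul H es e \<le> total_weight H es"
        unfolding cumul_def using total_filter_mono[of es _ "\<lambda>_. True"] by simp
      then have "quantile k H es e \<le> (4 * k * total_weight H es) div total_weight H es"
        unfolding quantile_def using W k by (intro zdiv_mono1 mult_left_mono) auto
      then show ?thesis using e \<open>0 \<le> quantile k H es (e - 1)\<close> W by (simp add: net_def)
    qed
  qed
  ultimately have "card (set (net k H es)) \<le> card {0<..4 * k}"
    by (metis card_inj_on_le finite_greaterThanAtMost_int)
  then show ?thesis using k by simp
qed

text \<open>Without a chosen access the quantile does not rise from \<open>a - 1\<close> to
  \<open>b\<close>, whereas a share of 1/(4k) of the weight in between would raise it by at least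
  one.\<close>

lemma net_free_interval:
  assumes k: "0 \<le> k" and W: "0 < total_weight H es" and "a \<le> b"
    and free: "\<And>e. a \<le> e \<Longrightarrow> e \<le> b \<Longrightarrow> e \<notin> set (net k H es)"
  shows "4 * k * total_weight H (filter (\<lambda>e. a \<le> e \<and> e \<le> b) es) < total_weight H es"
proof -
  have qstep: "quantile k H es e \<le> quantile k H es (e - 1)" if "a \<le> e" "e \<le> b" for e
  proof (cases "e \<in> set es")
    case True
    with free[OF that] show ?thesis by (auto simp: net_def not_less)
  next
    case False
    \<comment> \<open>Codes that are not listed do not change the cumulative weight.\<close>
    then have "filter (\<lambda>f. f \<le> e) es = filter (\<lambda>f. f \<le> e - 1) es"
      by (intro filter_cong) (auto simp: order_le_less)
    then show ?thesis by (simp add: quantile_def cumul_def)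
  qed
  have "quantile k H es b \<le> quantile k H es (a - 1)"
  proof -
    have "e \<le> b \<longrightarrow> quantile k H es e \<le> quantile k H es (a - 1)" if "a - 1 \<le> e" for e
      using that
    proof (induction e rule: int_ge_induct)
      case (step e)
      then show ?case using qstep[of "e + 1"]
        by auto
    qed simp
    then show ?thesis using \<open>a \<le> b\<close> by simp
  qed
  moreover have "cumul H es b = cumul H es (a - 1) + total_weight H (filter (\<lambda>e. a \<le> e \<and> e \<le> b) es)"
    unfolding cumul_def using \<open>a \<le> b\<close> by (induction es) (auto simp: total_Cons total_Nil)
  moreover have "(4 * k * cumul H es (a - 1) + total_weight H es) div total_weight H es = quantile k H es (a - 1) + 1"
    using W by (simp add: quantile_def)
  ultimately show ?thesis
    using zdiv_mono1[of "4 * k * cumul H es (a - 1) + total_weight H es" "4 * k * cumul H es b" "total_weight H es"] W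
    by (force simp: quantile_def distrib_left not_less)
qed

text \<open>The interval bound is applied to the hull of the least and the greatest listed element
  of \<open>P\<close>.\<close>

lemma net_free_convex:
  assumes k: "0 \<le> k" and W: "0 < total_weight H es"
    and free: "\<And>a b e. P a \<Longrightarrow> P b \<Longrightarrow> a \<le> e \<Longrightarrow> e \<le> b \<Longrightarrow> e \<notin> set (net k H es)"
  shows "4 * k * total_weight H (filter P es) < total_weight H es"
proof (cases "filter P es = []")
  case True
  then show ?thesis using W by (simp add: total_Nil)
next
  case False
  define S where "S = set (filter P es)"
  have S: "finite S" "S \<noteq> {}" using False unfolding S_def by (auto simp: filter_empty_conv)
  have mm: "P (Min S)" "P (Max S)" "Min S \<le> Max S"
    using Min_in[OF S] Max_in[OF S] S by (auto simp: S_def)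
  have "total_weight H (filter P es) \<le> total_weight H (filter (\<lambda>e. Min S \<le> e \<and> e \<le> Max S) es)"
    by (rule total_filter_mono) (auto intro!: Min_le Max_ge simp: S_def)
  then have "4 * k * total_weight H (filter P es) \<le> 4 * k * total_weight H (filter (\<lambda>e. Min S \<le> e \<and> e \<le> Max S) es)"
    using k by (intro mult_left_mono) auto
  also have "\<dots> < total_weight H es"
    by (rule net_free_interval[OF k W mm(3)]) (rule free[OF mm(1,2)])
  finally show ?thesis .
qed

lemma gap_weight:
  assumes k: "0 \<le> k" and W: "0 < total_weight H es" and s: "fst d = 1 \<or> fst d = - 1"
  shows "2 * k * total_weight H (gap (net k H es) d es) < total_weight H es"
proof -
  let ?N = "set (net k H es)"
  have "4 * k * total_weight H (filter (start_gap ?N d) es) < total_weight H es"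
    \<comment> \<open>A chosen access between two members \<open>a\<close> and \<open>b\<close>
      would contradict the start gap at \<open>b\<close> if the demand goes up, and at
      \<open>a\<close> if it goes down. For the end gap the roles are exchanged.\<close>
    by (rule net_free_convex[OF k W]) (use s in \<open>cases d; fastforce simp: start_gap_def\<close>)
  moreover have "4 * k * total_weight H (filter (end_gap ?N d) es) < total_weight H es"
    by (rule net_free_convex[OF k W]) (use s in \<open>cases d; fastforce simp: end_gap_def\<close>)
  moreover have "4 * k * total_weight H (gap (net k H es) d es)
      \<le> 4 * k * (total_weight H (filter (start_gap ?N d) es) + total_weight H (filter (end_gap ?N d) es))"
    unfolding gap_def using k by (intro mult_left_mono total_filter_disj) auto
  ultimately show ?thesis by (simp add: distrib_left)
qed

text \<open>Suppose \<open>A\<close> serves the demand by \<open>e\<close> and \<open>f\<close>,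
  both outside the gaps. Then \<open>N\<close> has a usable access not after \<open>e\<close> and a
  usable one not before \<open>f\<close>; together they serve the demand.\<close>

lemma gap_hits:
  assumes "A \<subseteq> set es" "served A d" "\<not> served (set N) d"
  shows "\<exists>a \<in> A. a \<in> set (gap N d es)"
proof (cases d)
  case (fields s p q c d')
  with assms(2) obtain e f where ef: "e \<in> A" "f \<in> A"
    "s * c \<le> s * (e - p)" "s * (e - p) \<le> s * (f - q)" "s * (f - q) \<le> s * d'"
    by (auto simp: served_def)
  have "start_gap (set N) d e \<or> end_gap (set N) d f"
  proof (rule ccontr)
    assume "\<not> ?thesis"
    then obtain e' f' where "e' \<in> set N" "s * c \<le> s * (e' - p)" "s * (e' - p) \<le> s * (e - p)"
      "f' \<in> set N" "s * (f - q) \<le> s * (f' - q)" "s * (f' - q) \<le> s * d'"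
      using ef by (auto simp: start_gap_def end_gap_def fields)
    with ef have "served (set N) d" by (force simp: served_def fields)
    with assms(3) show False by simp
  qed
  then show ?thesis using ef assms(1) by (auto simp: gap_def)
qed

section \<open>Convergence of the weights\<close>

lemma total_push:

  shows "total_weight (filter P es # H) es = total_weight H es + total_weight H (filter P es)"
proof -
  have "weight (filter P es # H) e = (if P e then 2 else 1) * weight H e" if "e \<in> set es" for e
    using that by (simp add: weight_def)
  then have "total_weight (filter P es # H) es = sum_list (map (\<lambda>e. (if P e then 2 else 1) * weight H e) es)"
    unfolding total_weight_def by (intro arg_cong[of _ _ sum_list] map_cong) auto
  also have "sum_list (map (\<lambda>e. (if P e then 2 else 1) * weight H e) es)
      = total_weight H es + total_weight H (filter P es)"
    by (induction es) (auto simp: total_Cons total_Nil)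
  finally show ?thesis .
qed

text \<open>The product of the weights over a serving set is the potential: one factor doubles and
  none decreases.\<close>

lemma prod_weight_push:
  assumes "finite A" "a \<in> A" "a \<in> set F"
  shows "2 * (\<Prod>e\<in>A. weight H e) \<le> (\<Prod>e\<in>A. weight (F # H) e)"
proof -
  have "2 * (\<Prod>e\<in>A. weight H e) = (2 * weight H a) * (\<Prod>e\<in>A - {a}. weight H e)"
    using assms by (simp add: prod.remove)
  also have "\<dots> \<le> weight (F # H) a * (\<Prod>e\<in>A - {a}. weight (F # H) e)"
    using assms(3) by (intro mult_mono prod_mono prod_nonneg) (auto simp: weight_def)
  also have "\<dots> = (\<Prod>e\<in>A. weight (F # H) e)"
    using assms by (simp add: prod.remove)
  finally show ?thesis .
qed

text \<open>In the application \<open>T\<close> is the total weight after \<open>r\<close> rounds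
  and \<open>m\<close> the number of accesses. The potential is at least 2^r and at most
  \<open>T ^ k\<close>, so the conclusion rules out \<open>r\<close> unsuccessful rounds. The growth
  is controlled by (1 + 1/(2k))^(2k) <= e <= 3.\<close>

lemma rounds_enough:
  fixes T :: real and m k r :: nat
  assumes k: "1 \<le> k" and r: "5 * k * m \<le> r" and T: "T \<le> m * (1 + 1 / (2 * real k)) ^ r" "0 \<le> T"
  shows "T ^ k < 2 ^ r"
proof -
  have "(1 + 1 / (2 * real k)) ^ (2 * k) \<le> exp (1 / (2 * real k)) ^ (2 * k)"
    by (intro power_mono exp_ge_add_one_self) auto
  also have "\<dots> = exp 1" using k by (simp flip: exp_of_nat_mult)
  also have "\<dots> \<le> 3" by (rule exp_le)
  finally have e: "(1 + 1 / (2 * real k)) ^ (2 * k) \<le> 3" .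
  have "(T ^ k)\<^sup>2 = T ^ (2 * k)" by (simp add: power_mult mult.commute)
  also have "\<dots> \<le> (m * (1 + 1 / (2 * real k)) ^ r) ^ (2 * k)"
    by (intro power_mono T)
  also have "\<dots> = (real m ^ 2) ^ k * ((1 + 1 / (2 * real k)) ^ (2 * k)) ^ r"
    by (simp add: power_mult_distrib flip: power_mult) (simp add: mult_ac)
  also have "\<dots> \<le> (real m ^ 2) ^ k * 3 ^ r"
    using e by (intro mult_left_mono power_mono) auto
  also have "\<dots> < (4 ^ m) ^ k * 3 ^ r"
  proof -
    have "m\<^sup>2 < 4 ^ m"
    proof -
      have "m < 2 ^ m" by simp
      then have "m\<^sup>2 < (2 ^ m)\<^sup>2" by (intro power_strict_mono) auto
      also have "\<dots> = (2\<^sup>2) ^ m" by (simp only: power_mult[symmetric] mult.commute)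
      finally show ?thesis by simp
    qed
    then have "real m ^ 2 < 4 ^ m" by (metis of_nat_less_iff of_nat_numeral of_nat_power)
    then show ?thesis using k by (intro mult_strict_right_mono power_strict_mono) auto
  qed
  also have "\<dots> \<le> 4 ^ r"
  proof -
    have "(4 ^ m) ^ k * 3 ^ (5 * k * m) \<le> (4 :: real) ^ (5 * k * m)"
    proof -
      \<comment> \<open>This is 972 <= 1024, the reason for the factor 5 in the number of
        rounds.\<close>
      have "(4 * 3 ^ 5) ^ (k * m) \<le> (4 ^ 5 :: real) ^ (k * m)" by (intro power_mono) auto
      then show ?thesis unfolding power_mult_distrib power_mult[symmetric] by (simp only: mult_ac)
    qed
    then have "(4 ^ m) ^ k * 3 ^ (5 * k * m) * 3 ^ (r - 5 * k * m) \<le> (4 :: real) ^ (5 * k * m) * 4 ^ (r - 5 * k * m)"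
      by (intro mult_mono power_mono) auto
    then show ?thesis using r by (simp add: mult.assoc flip: power_add)
  qed
  also have "(4 :: real) ^ r = (2 ^ r)\<^sup>2"
    by (simp add: power2_eq_square flip: power_mult_distrib)
  finally show ?thesis by (rule power_less_imp_less_base) simp
qed

text \<open>While some demand is unserved, each round at least doubles the potential, and the total
  grows at most by the factor 1 + 1/(2k) because the gap has less than a 1/(2k) share of it.\<close>

lemma reweight_progress:
  assumes A: "finite A" "A \<subseteq> set es" "card A = k" "1 \<le> k"
    and sat: "\<And>d. d \<in> set ds \<Longrightarrow> served A d \<and> (fst d = 1 \<or> fst d = - 1)"
    and unsat: "\<And>i. i < r \<Longrightarrow> \<exists>d \<in> set ds. \<not> served (set (net k ((reweight es ds k ^^ i) []) es)) d"
  shows "2 ^ r \<le> (\<Prod>e\<in>A. weight ((reweight es ds k ^^ r) []) e) \<and>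
    real_of_int (total_weight ((reweight es ds k ^^ r) []) es) \<le> length es * (1 + 1 / (2 * real k)) ^ r"
  using unsat
proof (induction r)
  case 0
  have "(\<Prod>e\<in>A. weight [] e) = 1" by (simp add: weight_def)
  moreover have "total_weight [] es = length es"
    by (induction es) (auto simp: total_weight_def weight_def)
  ultimately show ?case by simp
next
  case (Suc r)
  define H where "H = (reweight es ds k ^^ r) []"
  define N where "N = net k H es"
  from Suc have IH: "2 ^ r \<le> (\<Prod>e\<in>A. weight H e)"
    "real_of_int (total_weight H es) \<le> length es * (1 + 1 / (2 * real k)) ^ r" by (auto simp: H_def)
  have "\<exists>d \<in> set ds. \<not> served (set N) d" using Suc.prems[of r] by (simp add: N_def H_def)
  then obtain d ds' where f: "filter (\<lambda>d. \<not> served (set N) d) ds = d # ds'"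
    by (metis (no_types, lifting) filter_empty_conv neq_Nil_conv)
  then have d: "d \<in> set ds" "\<not> served (set N) d"
    by (metis (no_types, lifting) list.set_intros(1) mem_Collect_eq set_filter Int_iff)+
  have H': "(reweight es ds k ^^ Suc r) [] = gap N d es # H"
    using f by (simp add: reweight_def H_def[symmetric] N_def[symmetric])
  obtain a where a: "a \<in> A" "a \<in> set (gap N d es)" using gap_hits[OF A(2) _ d(2)] sat[OF d(1)] by blast
  have "2 ^ Suc r \<le> 2 * (\<Prod>e\<in>A. weight H e)" using IH(1) by simp
  also have "\<dots> \<le> (\<Prod>e\<in>A. weight (gap N d es # H) e)" by (rule prod_weight_push[OF A(1) a])
  finally have 1: "2 ^ Suc r \<le> (\<Prod>e\<in>A. weight (gap N d es # H) e)" .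
  have W: "0 < total_weight H es" using a A(2) weight_le_total[of a es H] weight_pos[of H a] by force
  have "2 * int k * total_weight H (gap N d es) < total_weight H es"
    using gap_weight[OF _ W, of "int k" d] sat[OF d(1)] by (simp add: N_def)
  then have "real_of_int (2 * int k * total_weight H (gap N d es)) \<le> total_weight H es" by linarith
  then have "total_weight H (gap N d es) \<le> total_weight H es / (2 * real k)"
    using A(4) by (simp add: field_simps)
  then have "total_weight (gap N d es # H) es \<le> total_weight H es * (1 + 1 / (2 * real k))"
    unfolding gap_def by (simp add: total_push distrib_left)
  also have "\<dots> \<le> length es * (1 + 1 / (2 * real k)) ^ r * (1 + 1 / (2 * real k))"
    by (intro mult_right_mono IH) auto
  finally show ?case using 1 unfolding H' by (simp add: mult_ac)
qed

lemma final_net_serves: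
  assumes A: "finite A" "A \<subseteq> set es" "card A = k"
    and sat: "\<And>d. d \<in> set ds \<Longrightarrow> served A d \<and> (fst d = 1 \<or> fst d = - 1)" and d: "d \<in> set ds"
  shows "served (set (final_net es ds k)) d"
proof (rule ccontr)
  assume contra: "\<not> served (set (final_net es ds k)) d"
  define R where "R = length (rounds es)"
  define H where "H i = (reweight es ds k ^^ i) []" for i
  \<comment> \<open>A served demand uses an element of \<open>A\<close>, so \<open>A\<close> is not
    empty.\<close>
  have k: "1 \<le> k" using sat[OF d] A by (cases d; cases k) (auto simp: served_def)
  \<comment> \<open>If all demands were served after some round, the history would stay fixed from
    then on and the final net would serve them too.\<close>
  have "\<exists>d \<in> set ds. \<not> served (set (net k (H i) es)) d" if "i \<le> R" for i
  proof (rule ccontr)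
    assume "\<not> ?thesis"
    then have "filter (\<lambda>d. \<not> served (set (net k (H i) es)) d) ds = []" by (simp add: filter_empty_conv)
    then have fp: "reweight es ds k (H i) = H i" by (simp add: reweight_def)
    have "H (i + j) = H i" for j
      by (induction j) (auto simp: H_def fp[unfolded H_def])
    from this[of "R - i"] that have "H R = H i" by simp
    with contra d \<open>\<not> ?thesis\<close> show False by (simp add: final_net_def R_def H_def)
  qed
  then have *: "2 ^ R \<le> (\<Prod>e\<in>A. weight (H R) e)"
    "real_of_int (total_weight (H R) es) \<le> length es * (1 + 1 / (2 * real k)) ^ R"
    using reweight_progress[OF A k sat, where r = R] by (auto simp: H_def)
  have "(\<Prod>e\<in>A. weight (H R) e) \<le> (\<Prod>e\<in>A. total_weight (H R) es)"
    using A(2) by (intro prod_mono) (auto simp: weight_le_total less_imp_le[OF weight_pos])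
  also have "\<dots> = total_weight (H R) es ^ k" by (simp add: A(3))
  finally have "2 ^ R \<le> total_weight (H R) es ^ k" using *(1) by simp
  then have "real_of_int (2 ^ R) \<le> real_of_int (total_weight (H R) es ^ k)" by linarith
  moreover have "real_of_int (total_weight (H R) es) ^ k < 2 ^ R"
  proof (rule rounds_enough[OF k _ *(2)])
    have "k \<le> card (set es)" using card_mono[OF _ A(2)] A(3) by simp
    then have "k \<le> length es" using card_length[of es] by simp
    then show "5 * k * length es \<le> R"
      by (simp add: R_def rounds_def length_concat o_def sum_list_triv)
  qed (simp add: total_nonneg)
  ultimately show False by simp
qed

section \<open>Ranks, slabs and accesses\<close>

text \<open>Subtracting 1 numbers the elements of \<open>S\<close> from 0. All reals have a rank
  because points of a solution may lie off the grid; they get the rank of the next smaller grid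
  line, or -1.\<close>

definition rank :: "real set \<Rightarrow> real \<Rightarrow> int" where
  "rank S x = int (card {s \<in> S. s \<le> x}) - 1"

definition coord :: "real set \<Rightarrow> int \<Rightarrow> real" where
  "coord S = inv_into S (rank S)"

lemma rank_mono:
  assumes "finite S" "x \<le> y" shows "rank S x \<le> rank S y"
proof -
  have "card {s \<in> S. s \<le> x} \<le> card {s \<in> S. s \<le> y}" using assms by (intro card_mono) auto
  then show ?thesis by (simp add: rank_def)
qed

lemma rank_strict_mono:
  assumes "finite S" "y \<in> S" "x < y" shows "rank S x < rank S y"
proof -
  have "y \<in> {s \<in> S. s \<le> y}" "y \<notin> {s \<in> S. s \<le> x}" using assms by auto
  moreover have "{s \<in> S. s \<le> x} \<subseteq> {s \<in> S. s \<le> y}" using assms by auto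
  ultimately have "{s \<in> S. s \<le> x} \<subset> {s \<in> S. s \<le> y}" by blast
  then have "card {s \<in> S. s \<le> x} < card {s \<in> S. s \<le> y}" using assms(1) by (intro psubset_card_mono) auto
  then show ?thesis by (simp add: rank_def)
qed

lemma rank_bij: assumes S: "finite S" shows "bij_betw (rank S) S {0..<int (card S)}"
proof -
  have "inj_on (rank S) S"
    by (rule linorder_inj_onI) (auto dest: rank_strict_mono[OF S])
  moreover have "rank S ` S \<subseteq> {0..<int (card S)}"
  proof safe
    fix s assume s: "s \<in> S"
    then have "{s} \<subseteq> {t \<in> S. t \<le> s}" by auto
    then have "1 \<le> card {t \<in> S. t \<le> s}" using S card_mono[of "{t \<in> S. t \<le> s}" "{s}"] by simp
    moreover have "card {t \<in> S. t \<le> s} \<le> card S" using S by (intro card_mono) auto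
    ultimately show "rank S s \<in> {0..<int (card S)}" by (simp add: rank_def)
  qed
  ultimately show ?thesis
    by (intro bij_betw_imageI card_subset_eq) (auto simp: card_image)
qed

lemma rank_range: "finite S \<Longrightarrow> s \<in> S \<Longrightarrow> 0 \<le> rank S s \<and> rank S s < card S"
  using bij_betwE[OF rank_bij] by fastforce

lemma coord_in: "finite S \<Longrightarrow> 0 \<le> r \<Longrightarrow> r < int (card S) \<Longrightarrow> coord S r \<in> S"
  unfolding coord_def by (rule inv_into_into) (use rank_bij[of S] in \<open>auto simp: bij_betw_def\<close>)

lemma rank_coord: "finite S \<Longrightarrow> 0 \<le> r \<Longrightarrow> r < int (card S) \<Longrightarrow> rank S (coord S r) = r"
  unfolding coord_def by (rule f_inv_into_f) (use rank_bij[of S] in \<open>auto simp: bij_betw_def\<close>)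

lemma coord_rank: "finite S \<Longrightarrow> s \<in> S \<Longrightarrow> coord S (rank S s) = s"
  unfolding coord_def by (rule inv_into_f_f) (use rank_bij[of S] in \<open>auto simp: bij_betw_def\<close>)

lemma coord_mono:
  assumes "finite S" "0 \<le> r" "r \<le> r'" "r' < int (card S)" shows "coord S r \<le> coord S r'"
proof (rule ccontr)
  assume "\<not> ?thesis"
  then have "rank S (coord S r') < rank S (coord S r)"
    using assms by (intro rank_strict_mono coord_in) auto
  then show False using assms by (simp add: rank_coord)
qed

section \<open>Slabs, levels and separating midpoints\<close>

definition slab :: "nat \<Rightarrow> nat \<Rightarrow> int \<Rightarrow> int" where
  "slab g j a = a div 2 ^ (g * j)"

definition separated :: "nat \<Rightarrow> nat \<Rightarrow> int \<Rightarrow> int \<Rightarrow> bool" where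
  "separated g j a b \<longleftrightarrow> slab g j a \<noteq> slab g j b \<and> slab g (Suc j) a = slab g (Suc j) b"

definition sep_level :: "nat \<Rightarrow> int \<Rightarrow> int \<Rightarrow> nat" where
  "sep_level g a b = (LEAST j. slab g (Suc j) a = slab g (Suc j) b)"

lemma slab_mono: "a \<le> b \<Longrightarrow> slab g j a \<le> slab g j b"
  unfolding slab_def by (rule zdiv_mono1) auto

lemma slab_slab: "i \<le> j \<Longrightarrow> slab g j a = slab g i a div 2 ^ (g * (j - i))"
  unfolding slab_def by (simp add: zdiv_zmult2_eq[symmetric] power_add[symmetric] distrib_left[symmetric])

text \<open>Coarser slabs are unions of finer ones, so two ranks that agree at one level agree at
  all later ones.\<close>

lemma sep_level_eq:
  assumes "separated g j a b" shows "sep_level g a b = j"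
  unfolding sep_level_def
proof (rule Least_equality)
  fix i assume i: "slab g (Suc i) a = slab g (Suc i) b"
  show "j \<le> i"
  proof (rule ccontr)
    assume "\<not> j \<le> i"
    then have "slab g j a = slab g j b" using i slab_slab[of "Suc i" j g] by simp
    with assms show False by (simp add: separated_def)
  qed
qed (use assms in \<open>simp add: separated_def\<close>)

text \<open>Slabs of level 0 are single ranks, and all ranks below \<open>2 ^ (g * g)\<close> share
  one slab of level \<open>g\<close>, so the two ranks merge at some step in between.\<close>

lemma separated_exists:
  assumes "a \<noteq> b" "0 \<le> a" "0 \<le> b" "a < 2 ^ (g * g)" "b < 2 ^ (g * g)"
  shows "\<exists>j<g. separated g j a b"
proof -
  let ?P = "\<lambda>j. slab g j a = slab g j b"
  have "?P g" using assms by (simp add: slab_def)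
  moreover have "\<not> ?P 0" using assms by (simp add: slab_def)
  ultimately obtain j where "j < g" "\<not> ?P j" "?P (Suc j)"
    using ex_least_nat_less[of ?P g] by blast
  then show ?thesis by (auto simp: separated_def)
qed

text \<open>The midpoint of the lowest dyadic interval containing both \<open>k\<close> and \<open>k'\<close> separates them, and
  it is computed from either of them alone.\<close>

definition midpoint :: "nat \<Rightarrow> int \<Rightarrow> int" where
  "midpoint i k = (2 * (k div 2 ^ Suc i) + 1) * 2 ^ i"

lemma midpoint_between:
  assumes "k < k'" "k div 2 ^ g = k' div 2 ^ g"
  shows "\<exists>i<g. midpoint i k = midpoint i k' \<and> k < midpoint i k \<and> midpoint i k \<le> k'"
proof -
  let ?P = "\<lambda>i. k div 2 ^ i = k' div 2 ^ i"
  have "\<not> ?P 0" using assms by simp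
  then obtain i where i: "i < g" "\<not> ?P i" "?P (Suc i)"
    using assms(2) ex_least_nat_less[of ?P g] by blast
  define t where "t = k div 2 ^ Suc i"
  have t: "(k div 2 ^ i) div 2 = t" "(k' div 2 ^ i) div 2 = t"
    using i(3) by (simp_all add: t_def zdiv_zmult2_eq[symmetric] mult.commute)
  have "k div 2 ^ i < k' div 2 ^ i"
    using i(2) zdiv_mono1[of k k' "2 ^ i"] assms(1) by simp
  \<comment> \<open>The halves of the common interval have the indices 2t and 2t + 1, and the
    midpoint is where the second half starts.\<close>
  with t have *: "k div 2 ^ i < 2 * t + 1" "2 * t + 1 \<le> k' div 2 ^ i" by linarith+
  have "k < (2 * t + 1) * 2 ^ i"
    using *(1) zdiv_mono1[of "(2 * t + 1) * 2 ^ i" k "2 ^ i"] by force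
  moreover have "(2 * t + 1) * 2 ^ i \<le> k'"
  proof -
    have "(2 * t + 1) * 2 ^ i \<le> k' div 2 ^ i * 2 ^ i" using *(2) by (intro mult_right_mono) auto
    also have "\<dots> = k' - k' mod 2 ^ i" by (rule minus_mod_eq_div_mult[symmetric])
    also have "\<dots> \<le> k'" by simp
    finally show ?thesis .
  qed
  moreover have "midpoint i k = (2 * t + 1) * 2 ^ i" "midpoint i k' = (2 * t + 1) * 2 ^ i"
    using i(3) unfolding midpoint_def t_def by auto
  ultimately show ?thesis using i(1) by auto
qed

section \<open>Shortest rectilinear paths\<close>

lemma M_connected_refl: "p \<in> X \<Longrightarrow> M_connected X p p"
  unfolding M_connected_def by (rule exI[of _ 0]) (auto simp: l1_dist_def)

lemma M_connected_step:
  assumes "p \<in> X" "aligned p r" "l1_dist p r + l1_dist r q = l1_dist p q" "M_connected X r q"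
  shows "M_connected X p q"
proof -
  obtain k x where x: "x 0 = r" "x k = q" "\<forall>i\<le>k. x i \<in> X" "\<forall>i<k. aligned (x i) (x (Suc i))"
    "(\<Sum>i<k. l1_dist (x i) (x (Suc i))) = l1_dist r q"
    using assms(4) unfolding M_connected_def by blast
  define x' where "x' i = (case i of 0 \<Rightarrow> p | Suc j \<Rightarrow> x j)" for i
  have "\<forall>i\<le>Suc k. x' i \<in> X" "\<forall>i<Suc k. aligned (x' i) (x' (Suc i))"
    using x assms by (auto simp: x'_def split: nat.split)
  moreover have "(\<Sum>i<Suc k. l1_dist (x' i) (x' (Suc i))) = l1_dist p q"
    using x assms(3) by (simp add: sum.lessThan_Suc_shift x'_def del: sum.lessThan_Suc)
  ultimately show ?thesis unfolding M_connected_def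
    using x by (intro exI[of _ "Suc k"] exI[of _ x']) (auto simp: x'_def)
qed

lemma M_connected_sym:
  assumes "M_connected X p q" shows "M_connected X q p"
proof -
  obtain k x where x: "x 0 = p" "x k = q" "\<forall>i\<le>k. x i \<in> X" "\<forall>i<k. aligned (x i) (x (Suc i))"
    "(\<Sum>i<k. l1_dist (x i) (x (Suc i))) = l1_dist p q"
    using assms unfolding M_connected_def by blast
  have l1: "l1_dist a b = l1_dist b a" for a b by (simp add: l1_dist_def abs_minus_commute)
  have al: "aligned a b = aligned b a" for a b by (auto simp: aligned_def)
  define x' where "x' i = x (k - i)" for i
  have "\<forall>i<k. aligned (x' i) (x' (Suc i))"
  proof safe
    fix i assume "i < k"
    then have "x' i = x (Suc (k - Suc i))" by (simp add: x'_def Suc_diff_Suc)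
    then show "aligned (x' i) (x' (Suc i))" using x(4) \<open>i < k\<close> by (simp add: x'_def al)
  qed
  moreover have "(\<Sum>i<k. l1_dist (x' i) (x' (Suc i))) = (\<Sum>i<k. l1_dist (x i) (x (Suc i)))"
    by (subst sum.nat_diff_reindex[symmetric], intro sum.cong) (auto simp: x'_def l1 Suc_diff_Suc)
  ultimately show ?thesis unfolding M_connected_def
    using x by (intro exI[of _ k] exI[of _ x']) (auto simp: x'_def l1)
qed

text \<open>This is the shape of all paths in the constructed solution; consecutive corners may
  coincide. The two alternatives are upward and downward demands.\<close>

lemma M_connected_staircase:
  assumes "x\<^sub>0 \<le> x\<^sub>1" "x\<^sub>1 \<le> x\<^sub>2" "x\<^sub>2 \<le> x\<^sub>3" "x\<^sub>3 \<le> x\<^sub>4"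
    and "y\<^sub>0 \<le> h \<and> h \<le> h' \<and> h' \<le> y\<^sub>1 \<or> y\<^sub>0 \<ge> h \<and> h \<ge> h' \<and> h' \<ge> y\<^sub>1"
    and "{(x\<^sub>0, y\<^sub>0), (x\<^sub>1, y\<^sub>0), (x\<^sub>1, h), (x\<^sub>2, h), (x\<^sub>2, h'), (x\<^sub>3, h'), (x\<^sub>3, y\<^sub>1), (x\<^sub>4, y\<^sub>1)} \<subseteq> X"
  shows "M_connected X (x\<^sub>0, y\<^sub>0) (x\<^sub>4, y\<^sub>1)"
proof -
  have "M_connected X (x\<^sub>4, y\<^sub>1) (x\<^sub>4, y\<^sub>1)" using assms(6) by (intro M_connected_refl) simp
  then have "M_connected X (x\<^sub>3, y\<^sub>1) (x\<^sub>4, y\<^sub>1)"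
    by (rule M_connected_step[rotated 3]) (use assms in \<open>auto simp: aligned_def l1_dist_def\<close>)
  then have "M_connected X (x\<^sub>3, h') (x\<^sub>4, y\<^sub>1)"
    by (rule M_connected_step[rotated 3]) (use assms in \<open>auto simp: aligned_def l1_dist_def\<close>)
  then have "M_connected X (x\<^sub>2, h') (x\<^sub>4, y\<^sub>1)"
    by (rule M_connected_step[rotated 3]) (use assms in \<open>auto simp: aligned_def l1_dist_def\<close>)
  then have "M_connected X (x\<^sub>2, h) (x\<^sub>4, y\<^sub>1)"
    by (rule M_connected_step[rotated 3]) (use assms in \<open>auto simp: aligned_def l1_dist_def\<close>)
  then have "M_connected X (x\<^sub>1, h) (x\<^sub>4, y\<^sub>1)"
    by (rule M_connected_step[rotated 3]) (use assms in \<open>auto simp: aligned_def l1_dist_def\<close>)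
  then have "M_connected X (x\<^sub>1, y\<^sub>0) (x\<^sub>4, y\<^sub>1)"
    by (rule M_connected_step[rotated 3]) (use assms in \<open>auto simp: aligned_def l1_dist_def\<close>)
  then show ?thesis
    by (rule M_connected_step[rotated 3]) (use assms in \<open>auto simp: aligned_def l1_dist_def\<close>)
qed

text \<open>A single decreasing step would make the sum of absolute values exceed the telescoping
  sum of signed steps.\<close>

lemma telescope_abs_monotone:
  fixes z :: "nat \<Rightarrow> real"
  assumes eq: "(\<Sum>i<k. \<bar>z i - z (Suc i)\<bar>) \<le> \<bar>z 0 - z k\<bar>" and le: "z 0 \<le> z k" and i: "i < k"
  shows "z i \<le> z (Suc i)"
proof (rule ccontr)
  assume "\<not> ?thesis"
  then have "(\<Sum>i<k. z (Suc i) - z i) < (\<Sum>i<k. \<bar>z i - z (Suc i)\<bar>)"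
    using i by (intro sum_strict_mono_ex1) (auto intro!: bexI[of _ i])
  also have "\<dots> \<le> z k - z 0" using eq le by simp
  finally show False by (simp add: sum_lessThan_telescope)
qed

lemma telescope_abs_ge:
  fixes z :: "nat \<Rightarrow> real" shows "\<bar>z 0 - z k\<bar> \<le> (\<Sum>i<k. \<bar>z i - z (Suc i)\<bar>)"
  using sum_abs[of "\<lambda>i. z (Suc i) - z i" "{..<k}"]
  by (simp add: sum_lessThan_telescope abs_minus_commute)

text \<open>The variation of each coordinate along the path is at least its net change. The two
  together attain equality, hence so does each, and both coordinates are monotone. The sign
  \<open>s\<close> treats both directions at once.\<close>

lemma M_connected_monotone_path:
  assumes "M_connected X p q" and s: "s = 1 \<or> s = (- 1 :: real)"
    and le: "fst p \<le> fst q" "s * snd p \<le> s * snd q"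
  obtains k x where "x 0 = p" "x k = q" "\<And>i. i \<le> k \<Longrightarrow> x i \<in> X"
    "\<And>i. i < k \<Longrightarrow> aligned (x i) (x (Suc i))"
    "\<And>i j. i \<le> j \<Longrightarrow> j \<le> k \<Longrightarrow> fst (x i) \<le> fst (x j) \<and> s * snd (x i) \<le> s * snd (x j)"
proof -
  obtain k x where x: "x 0 = p" "x k = q" "\<forall>i\<le>k. x i \<in> X" "\<forall>i<k. aligned (x i) (x (Suc i))"
    "(\<Sum>i<k. l1_dist (x i) (x (Suc i))) = l1_dist p q"
    using assms(1) unfolding M_connected_def by blast
  have sabs: "\<bar>s * a - s * b\<bar> = \<bar>a - b\<bar>" for a b using s by auto
  have "(\<Sum>i<k. \<bar>fst (x i) - fst (x (Suc i))\<bar>) + (\<Sum>i<k. \<bar>s * snd (x i) - s * snd (x (Suc i))\<bar>)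
      = \<bar>fst (x 0) - fst (x k)\<bar> + \<bar>s * snd (x 0) - s * snd (x k)\<bar>"
    using x by (simp add: l1_dist_def sum.distrib sabs)
  with telescope_abs_ge[of "\<lambda>i. fst (x i)" k] telescope_abs_ge[of "\<lambda>i. s * snd (x i)" k]
  have "(\<Sum>i<k. \<bar>fst (x i) - fst (x (Suc i))\<bar>) \<le> \<bar>fst (x 0) - fst (x k)\<bar>"
    "(\<Sum>i<k. \<bar>s * snd (x i) - s * snd (x (Suc i))\<bar>) \<le> \<bar>s * snd (x 0) - s * snd (x k)\<bar>" by linarith+
  note st = telescope_abs_monotone[OF this(1)] telescope_abs_monotone[OF this(2)]
  have mono: "fst (x i) \<le> fst (x j) \<and> s * snd (x i) \<le> s * snd (x j)" if "i \<le> j" "j \<le> k" for i j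
    using that
  proof (induction j rule: dec_induct)
    case (step j)
    then show ?case using st[of j] x le by force
  qed simp
  from x mono show ?thesis by (intro that[of x k]) auto
qed

section \<open>From a solution to accesses\<close>

definition right_neighbour :: "point set \<Rightarrow> point \<Rightarrow> point \<Rightarrow> bool" where
  "right_neighbour X u v \<longleftrightarrow> u \<in> X \<and> v \<in> X \<and> snd u = snd v \<and> fst u < fst v \<and>
     (\<forall>w \<in> X. snd w = snd u \<longrightarrow> fst w \<le> fst u \<or> fst v \<le> fst w)"

lemma right_neighbour_unique:
  "right_neighbour X u v \<Longrightarrow> right_neighbour X u v' \<Longrightarrow> v = v'"
  "right_neighbour X u v \<Longrightarrow> right_neighbour X u' v \<Longrightarrow> u = u'"
  unfolding right_neighbour_def by (metis prod_eqI antisym not_less)+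

text \<open>A path edge may jump over points of its row, so a crossing is charged to consecutive
  points: the last one of the row inside the downward closed set \<open>T\<close> and the first one
  outside.\<close>

lemma right_neighbour_crossing:
  assumes X: "finite X" "x \<in> X" "y \<in> X" and row: "snd x = snd y" and T: "T (fst x)" "\<not> T (fst y)"
    and down: "\<And>a b. a \<le> b \<Longrightarrow> T b \<Longrightarrow> T a"
  shows "\<exists>u v. right_neighbour X u v \<and> snd u = snd x \<and> T (fst u) \<and> \<not> T (fst v) \<and>
    fst x \<le> fst u \<and> fst v \<le> fst y"
proof -
  define U where "U = {w \<in> X. snd w = snd x \<and> T (fst w)}"
  define V where "V = {w \<in> X. snd w = snd x \<and> \<not> T (fst w)}"
  have fin: "finite U" "finite V" using X by (auto simp: U_def V_def)
  have ne: "x \<in> U" "y \<in> V" using X row T by (auto simp: U_def V_def)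
  have "Max (fst ` U) \<in> fst ` U" "Min (fst ` V) \<in> fst ` V"
    using fin ne by (intro Max_in Min_in; auto)+
  then obtain u v where u: "u \<in> U" "fst u = Max (fst ` U)" and v: "v \<in> V" "fst v = Min (fst ` V)"
    by (metis imageE)
  have um: "fst w \<le> fst u" if "w \<in> U" for w using u fin that by simp
  have vm: "fst v \<le> fst w" if "w \<in> V" for w using v fin that by simp
  have "fst u < fst v" using u(1) v(1) down[of "fst v" "fst u"] by (force simp: U_def V_def)
  moreover have "\<forall>w \<in> X. snd w = snd u \<longrightarrow> fst w \<le> fst u \<or> fst v \<le> fst w"
    using um vm u(1) by (auto simp: U_def V_def)
  ultimately have "right_neighbour X u v"
    using u(1) v(1) by (auto simp: right_neighbour_def U_def V_def)
  moreover have "snd u = snd x" "T (fst u)" "\<not> T (fst v)" using u(1) v(1) by (auto simp: U_def V_def)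
  ultimately show ?thesis using um[OF ne(1)] vm[OF ne(2)] by blast
qed

text \<open>A mixed-radix code whose last digit is the row, so that the accesses of one slab are
  consecutive integers, as the quantile argument needs.\<close>

definition key :: "int \<Rightarrow> nat \<Rightarrow> int \<Rightarrow> int \<Rightarrow> int" where
  "key n j k c = (int j * n + k) * n + c"

text \<open>The level is determined by the pair. A pair is therefore charged for one level only,
  which avoids a factor \<open>g\<close> in the number of accesses.\<close>

definition pair_keys :: "nat \<Rightarrow> point set \<Rightarrow> point \<Rightarrow> point \<Rightarrow> int set" where
  "pair_keys g P u v = (let r = rank (fst ` P); j = sep_level g (r (fst u)) (r (fst v)) in
     (\<lambda>z. key (card P) j (slab g j (r (fst z))) (rank (snd ` P) (snd z))) ` {u, v})"

text \<open>
  A point without a neighbour on one side contributes arbitrary keys here; they only count towards the cardinality.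
\<close>

definition accesses :: "nat \<Rightarrow> point set \<Rightarrow> point set \<Rightarrow> int set" where
  "accesses g P Q = (\<Union>c\<in>Q. pair_keys g P c (THE v. right_neighbour (P \<union> Q) c v)
     \<union> pair_keys g P (THE u. right_neighbour (P \<union> Q) u c) c)"

text \<open>Each point of \<open>Q\<close> contributes one pair on each side, and a pair has at most
  two keys.\<close>

lemma card_accesses:
  assumes "finite Q" shows "finite (accesses g P Q)" "card (accesses g P Q) \<le> 4 * card Q"
proof -
  have fin: "finite (pair_keys g P u v)" for u v by (simp add: pair_keys_def Let_def)
  then show "finite (accesses g P Q)" using assms by (simp add: accesses_def)
  have two: "card (pair_keys g P u v) \<le> 2" for u v
    unfolding pair_keys_def Let_def by (rule order_trans[OF card_image_le]) (auto simp: card_insert_if)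
  have "card (accesses g P Q) \<le> (\<Sum>c\<in>Q. card (pair_keys g P c (THE v. right_neighbour (P \<union> Q) c v)
     \<union> pair_keys g P (THE u. right_neighbour (P \<union> Q) u c) c))"
    unfolding accesses_def using assms by (rule card_UN_le)
  also have "\<dots> \<le> (\<Sum>c\<in>Q. 4)"
    by (intro sum_mono order_trans[OF card_Un_le order_trans[OF add_mono[OF two two]]]) simp
  finally show "card (accesses g P Q) \<le> 4 * card Q" by simp
qed

lemma right_neighbour_accesses:
  assumes P: "inj_on snd P" and nb: "right_neighbour (P \<union> Q) u v"
    and sep: "separated g j (rank (fst ` P) (fst u)) (rank (fst ` P) (fst v))"
  shows "key (card P) j (slab g j (rank (fst ` P) (fst u))) (rank (snd ` P) (snd u)) \<in> accesses g P Q"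
    "key (card P) j (slab g j (rank (fst ` P) (fst v))) (rank (snd ` P) (snd v)) \<in> accesses g P Q"
proof -
  \<comment> \<open>Two input points never share a row.\<close>
  have "u \<in> Q \<or> v \<in> Q"
    using nb P unfolding right_neighbour_def by (metis Un_iff inj_onD less_irrefl)
  moreover have "(THE v. right_neighbour (P \<union> Q) u v) = v" "(THE u. right_neighbour (P \<union> Q) u v) = u"
    using nb right_neighbour_unique by (blast intro: the_equality)+
  moreover have "pair_keys g P c (THE v. right_neighbour (P \<union> Q) c v) \<subseteq> accesses g P Q"
    "pair_keys g P (THE u. right_neighbour (P \<union> Q) u c) c \<subseteq> accesses g P Q" if "c \<in> Q" for c
    using that by (auto simp: accesses_def)
  ultimately have "pair_keys g P u v \<subseteq> accesses g P Q" by metis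
  then show "key (card P) j (slab g j (rank (fst ` P) (fst u))) (rank (snd ` P) (snd u)) \<in> accesses g P Q"
    "key (card P) j (slab g j (rank (fst ` P) (fst v))) (rank (snd ` P) (snd v)) \<in> accesses g P Q"
    using sep_level_eq[OF sep] by (auto simp: pair_keys_def Let_def)
qed

definition valid_keys :: "nat \<Rightarrow> int \<Rightarrow> int set" where
  "valid_keys g n = {key n j k c |j k c. j < g \<and> 0 \<le> k \<and> k < n \<and> 0 \<le> c \<and> c < n}"

text \<open>Take the first edge of the path that leaves the slab of \<open>p\<close> and the first
  that reaches the slab of \<open>q\<close>. Both are horizontal, and the row neighbours around the
  crossings give the two accesses, whose rows are in order because the path is monotone. The
  intersection with \<open>valid_keys\<close> restricts to the keys among which the algorithm
  searches.\<close>

lemma accesses_serve: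
  assumes P: "finite P" "inj_on fst P" "inj_on snd P" and Q: "finite Q"
    and pq: "p \<in> P" "q \<in> P" "fst p < fst q" and conn: "M_connected (P \<union> Q) p q"
    and s: "s = 1 \<or> s = - 1" "of_int s * snd p \<le> of_int s * snd q"
    and j: "j < g" "separated g j (rank (fst ` P) (fst p)) (rank (fst ` P) (fst q))"
  shows "served (accesses g P Q \<inter> valid_keys g (card P))
    (s, key (card P) j (slab g j (rank (fst ` P) (fst p))) 0, key (card P) j (slab g j (rank (fst ` P) (fst q))) 0,
      rank (snd ` P) (snd p), rank (snd ` P) (snd q))"
proof -
  define X where "X = P \<union> Q"
  define r where "r t = rank (fst ` P) t" for t
  define h where "h t = rank (snd ` P) t" for t
  define l where "l t = slab g j (r t)" for t
  have finX: "finite X" using P Q by (simp add: X_def)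
  have r_mono: "a \<le> b \<Longrightarrow> r a \<le> r b" for a b unfolding r_def using P by (intro rank_mono) auto
  have l_mono: "a \<le> b \<Longrightarrow> l a \<le> l b" for a b unfolding l_def by (intro slab_mono r_mono)
  have l_lt: "l (fst p) < l (fst q)"
    using j(2) l_mono[of "fst p" "fst q"] pq(3) by (simp add: separated_def l_def r_def)
  have sh: "s * h a \<le> s * h b" if "of_int s * a \<le> of_int s * b" for a b
    using s(1) that P by (auto simp: h_def intro!: rank_mono)
  have "real_of_int s = 1 \<or> real_of_int s = - 1" using s(1) by auto
  from M_connected_monotone_path[OF conn this _ s(2)] pq(3) obtain k x where
    x: "x 0 = p" "x k = q" "\<And>i. i \<le> k \<Longrightarrow> x i \<in> X" "\<And>i. i < k \<Longrightarrow> aligned (x i) (x (Suc i))"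
    and mono: "\<And>i j. i \<le> j \<Longrightarrow> j \<le> k \<Longrightarrow> fst (x i) \<le> fst (x j) \<and> of_int s * snd (x i) \<le> of_int s * snd (x j)"
    unfolding X_def by (metis less_imp_le)
  have crossing: "\<exists>u v. right_neighbour X u v \<and> snd u = snd (x i) \<and> T (fst u) \<and> \<not> T (fst v)
      \<and> fst p \<le> fst u \<and> fst v \<le> fst q"
    if i: "i < k" and T: "T (fst (x i))" "\<not> T (fst (x (Suc i)))" and down: "\<And>a b. a \<le> b \<Longrightarrow> T b \<Longrightarrow> T a"
    for i and T :: "real \<Rightarrow> bool"
  proof -
    have "snd (x i) = snd (x (Suc i))" using x(4)[OF i] T by (auto simp: aligned_def)
    from right_neighbour_crossing[where T = T, OF finX x(3) x(3) this T] i down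
    obtain u v where "right_neighbour X u v" "snd u = snd (x i)" "T (fst u)" "\<not> T (fst v)"
      "fst (x i) \<le> fst u" "fst v \<le> fst (x (Suc i))" by (metis Suc_leI less_imp_le)
    moreover have "fst p \<le> fst (x i)" "fst (x (Suc i)) \<le> fst q"
      using mono[of 0 i] mono[of "Suc i" k] i x by auto
    ultimately show ?thesis by (meson order_trans)
  qed
  \<comment> \<open>Everything between \<open>p\<close> and \<open>q\<close> lies in their common
    slab of level \<open>j + 1\<close>.\<close>
  have sep: "separated g j (r (fst u)) (r (fst v))"
    if "fst p \<le> fst u" "fst u < fst v" "fst v \<le> fst q" "l (fst u) \<noteq> l (fst v)" for u v :: point
  proof -
    have "slab g (Suc j) (r (fst p)) \<le> slab g (Suc j) (r (fst u))"
      "slab g (Suc j) (r (fst u)) \<le> slab g (Suc j) (r (fst v))"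
      "slab g (Suc j) (r (fst v)) \<le> slab g (Suc j) (r (fst q))"
      using that by (auto intro!: slab_mono r_mono)
    then show ?thesis using j(2) that(4) by (simp add: separated_def l_def r_def)
  qed
  have ex: "\<exists>i<k. T (fst (x i)) \<and> \<not> T (fst (x (Suc i))) \<and> (\<forall>i'\<le>i. T (fst (x i')))"
    if "T (fst p)" "\<not> T (fst q)" for T :: "real \<Rightarrow> bool"
  proof -
    from that x have "\<exists>i<k. (\<forall>i'\<le>i. \<not> \<not> T (fst (x i'))) \<and> \<not> T (fst (x (Suc i)))"
      by (intro ex_least_nat_less) auto
    then show ?thesis by blast
  qed
  obtain i where i: "i < k" "l (fst (x i)) \<le> l (fst p)" "\<not> l (fst (x (Suc i))) \<le> l (fst p)"
    "\<And>i'. i' \<le> i \<Longrightarrow> l (fst (x i')) \<le> l (fst p)"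
    using ex[of "\<lambda>t. l t \<le> l (fst p)"] l_lt by auto
  obtain i' where i': "i' < k" "l (fst (x i')) < l (fst q)" "\<not> l (fst (x (Suc i'))) < l (fst q)"
    using ex[of "\<lambda>t. l t < l (fst q)"] l_lt by auto
  \<comment> \<open>Up to index \<open>i\<close> the path has not left the slab of \<open>p\<close>,
    so it has not reached the slab of \<open>q\<close>.\<close>
  have ii: "i \<le> i'"
  proof (rule ccontr)
    assume "\<not> i \<le> i'"
    with i(4)[of "Suc i'"] i'(3) l_lt show False by simp
  qed
  obtain u v where uv: "right_neighbour X u v" "snd u = snd (x i)" "l (fst u) \<le> l (fst p)"
    "\<not> l (fst v) \<le> l (fst p)" "fst p \<le> fst u" "fst v \<le> fst q"
    using crossing[of i "\<lambda>t. l t \<le> l (fst p)"] i l_mono by (smt (verit))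
  obtain u' v' where uv': "right_neighbour X u' v'" "snd u' = snd (x i')" "l (fst u') < l (fst q)"
    "\<not> l (fst v') < l (fst q)" "fst p \<le> fst u'" "fst v' \<le> fst q"
    using crossing[of i' "\<lambda>t. l t < l (fst q)"] i' l_mono by (smt (verit))
  define e where "e = key (card P) j (l (fst p)) (h (snd (x i)))"
  define f where "f = key (card P) j (l (fst q)) (h (snd (x i')))"
  have nb: "fst u < fst v" "fst u' < fst v'" "snd v' = snd u'"
    using uv(1) uv'(1) by (auto simp: right_neighbour_def)
  have "l (fst u) = l (fst p)" using uv l_mono[of "fst p" "fst u"] by simp
  then have "e \<in> accesses g P Q"
    using right_neighbour_accesses(1)[OF P(3) uv(1)[unfolded X_def], of g j] sep[of u v] uv nb
    by (simp add: e_def l_def r_def h_def)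
  moreover have "l (fst v') = l (fst q)" using uv' l_mono[of "fst v'" "fst q"] by simp
  then have "f \<in> accesses g P Q"
    using right_neighbour_accesses(2)[OF P(3) uv'(1)[unfolded X_def], of g j] sep[of u' v'] uv' nb
    by (simp add: f_def l_def r_def h_def)
  moreover have c: "card (fst ` P) = card P" "card (snd ` P) = card P"
    using P by (simp_all add: card_image)
  have rr: "0 \<le> r (fst z) \<and> r (fst z) < card P" "0 \<le> h (snd z) \<and> h (snd z) < card P" if "z \<in> P" for z
    using rank_range[of "fst ` P" "fst z"] rank_range[of "snd ` P" "snd z"] P that c
    by (auto simp: r_def h_def)
  have lr: "0 \<le> l (fst z) \<and> l (fst z) < card P" if "z \<in> P" for z
  proof -
    have "r (fst z) div 2 ^ (g * j) \<le> r (fst z)"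
      using rr[OF that] zdiv_mono2[of "r (fst z)" 1 "2 ^ (g * j)"] by simp
    then show ?thesis using rr[OF that] by (simp add: l_def slab_def pos_imp_zdiv_nonneg_iff)
  qed
  have hh: "s * h (snd p) \<le> s * h (snd (x i))" "s * h (snd (x i)) \<le> s * h (snd (x i'))"
    "s * h (snd (x i')) \<le> s * h (snd q)"
    using mono[of 0 i] mono[of i i'] mono[of i' k] i i' ii x by (auto intro!: sh)
  have "0 \<le> h (snd (x i)) \<and> h (snd (x i)) < card P" "0 \<le> h (snd (x i')) \<and> h (snd (x i')) < card P"
    using hh rr(2)[OF pq(1)] rr(2)[OF pq(2)] s(1) by auto
  then have "e \<in> valid_keys g (card P)" "f \<in> valid_keys g (card P)"
    using lr[OF pq(1)] lr[OF pq(2)] j(1) unfolding e_def f_def valid_keys_def by blast+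
  moreover have "e - key (card P) j (l (fst p)) 0 = h (snd (x i))"
    "f - key (card P) j (l (fst q)) 0 = h (snd (x i'))"
    by (simp_all add: e_def f_def key_def)
  ultimately show ?thesis using hh
    unfolding served_def prod.case l_def[symmetric] r_def[symmetric] h_def[symmetric]
    by (intro bexI[of _ e] bexI[of _ f]) auto
qed

section \<open>From accesses to a solution\<close>

definition touch :: "nat \<Rightarrow> nat \<Rightarrow> int \<Rightarrow> int set" where
  "touch g j k = insert (k * 2 ^ (g * j)) (insert ((k + 1) * 2 ^ (g * j))
     ((\<lambda>i. midpoint i k * 2 ^ (g * j)) ` {..<g}))"

text \<open>The path follows the row of \<open>p\<close> to the right boundary of its slab, changes
  there to the first accessed row, changes to the second one at a column in the \<open>touch\<close>
  sets of both slabs, and reaches the row of \<open>q\<close> at the left boundary of the slab of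
  \<open>q\<close>.\<close>

lemma served_connected:
  fixes P :: "point set"
  defines "n \<equiv> int (card P)" and "r \<equiv> \<lambda>p. rank (fst ` P) (fst p)" and "h \<equiv> \<lambda>p. rank (snd ` P) (snd p)"
  assumes P: "finite P" "inj_on fst P" "inj_on snd P"
    and pq: "p \<in> P" "q \<in> P" "fst p < fst q" and s: "s = 1 \<or> s = - 1"
    and j: "separated g j (r p) (r q)"
    and served: "served N (s, key n j (slab g j (r p)) 0, key n j (slab g j (r q)) 0, h p, h q)"
    and Qp: "(slab g j (r p) + 1) * 2 ^ (g * j) < n \<Longrightarrow>
      (coord (fst ` P) ((slab g j (r p) + 1) * 2 ^ (g * j)), snd p) \<in> Q"
    and Qq: "(coord (fst ` P) (slab g j (r q) * 2 ^ (g * j)), snd q) \<in> Q"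
    and Qe: "\<And>k c t. key n j k c \<in> N \<Longrightarrow> 0 \<le> k \<Longrightarrow> k < n \<Longrightarrow> 0 \<le> c \<Longrightarrow> c < n \<Longrightarrow> t \<in> touch g j k \<Longrightarrow>
      0 \<le> t \<Longrightarrow> t < n \<Longrightarrow> (coord (fst ` P) t, coord (snd ` P) c) \<in> Q"
  shows "M_connected (P \<union> Q) p q"
proof -
  define X where "X = coord (fst ` P)"
  define Y where "Y = coord (snd ` P)"
  define b where "b = (2 :: int) ^ (g * j)"
  define k where "k = slab g j (r p)"
  define k' where "k' = slab g j (r q)"
  have b: "0 < b" by (simp add: b_def)
  have fin: "finite (fst ` P)" "finite (snd ` P)" using P by auto
  have c: "int (card (fst ` P)) = n" "int (card (snd ` P)) = n"
    using P by (simp_all add: card_image n_def)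
  have range: "0 \<le> r z" "r z < n" "0 \<le> h z" "h z < n" if "z \<in> P" for z
    using rank_range[OF fin(1), of "fst z"] rank_range[OF fin(2), of "snd z"] that c
    by (auto simp: r_def h_def)
  have XY: "fst z = X (r z)" "snd z = Y (h z)" if "z \<in> P" for z
    using that fin by (simp_all add: X_def Y_def r_def h_def coord_rank)
  have rpq: "r p < r q" unfolding r_def using pq fin by (intro rank_strict_mono) auto
  from served obtain e f where ef: "e \<in> N" "f \<in> N" "s * h p \<le> s * (e - key n j k 0)"
    "s * (e - key n j k 0) \<le> s * (f - key n j k' 0)" "s * (f - key n j k' 0) \<le> s * h q"
    by (auto simp: served_def k_def k'_def)
  define u where "u = e - key n j k 0"
  define v where "v = f - key n j k' 0"
  have uv: "s * h p \<le> s * u" "s * u \<le> s * v" "s * v \<le> s * h q" using ef by (auto simp: u_def v_def)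
  have ef': "key n j k u \<in> N" "key n j k' v \<in> N" using ef by (auto simp: u_def v_def key_def)
  have uvr: "0 \<le> u" "u < n" "0 \<le> v" "v < n"
    using uv range[OF pq(1)] range[OF pq(2)] s by auto
  have "k \<noteq> k'" "slab g (Suc j) (r p) = slab g (Suc j) (r q)" using j by (auto simp: separated_def k_def k'_def)
  moreover have "k \<le> k'" unfolding k_def k'_def using rpq by (intro slab_mono) simp
  moreover have "slab g (Suc j) a = slab g j a div 2 ^ g" for a using slab_slab[of j "Suc j" g a] by simp
  \<comment> \<open>Both slabs lie in one slab of the next level, so their indices agree after
    division by \<open>2 ^ g\<close>, and the midpoint of one of \<open>g\<close> dyadic levels
    separates them.\<close>
  ultimately obtain i where i: "i < g" "midpoint i k = midpoint i k'" "k < midpoint i k" "midpoint i k \<le> k'"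
    using midpoint_between[of k k' g] by (auto simp: k_def k'_def)
  have kb: "k * b \<le> r p" "r p < (k + 1) * b" "k' * b \<le> r q"
  proof -
    have "a div b * b \<le> a \<and> a < (a div b + 1) * b" for a
      using div_mult_mod_eq[of a b] pos_mod_bound[OF b, of a] pos_mod_sign[OF b, of a]
      unfolding distrib_right by linarith
    then show "k * b \<le> r p" "r p < (k + 1) * b" "k' * b \<le> r q"
      by (simp_all add: k_def k'_def slab_def b_def)
  qed
  have k0: "0 \<le> k" "k < n" "0 \<le> k'" "k' < n"
  proof -
    have "0 \<le> a div b \<and> a div b \<le> a" if "0 \<le> a" for a
      using that b zdiv_mono2[of a 1 b] by (simp add: pos_imp_zdiv_nonneg_iff)
    then show "0 \<le> k" "k < n" "0 \<le> k'" "k' < n"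
      using range[OF pq(1)] range[OF pq(2)] unfolding k_def k'_def slab_def b_def[symmetric]
      by (meson order_le_less_trans)+
  qed
  define m where "m = midpoint i k * b"
  have m: "(k + 1) * b \<le> m" "m \<le> k' * b"
    unfolding m_def using i b by (auto intro!: mult_right_mono)
  have ord: "0 \<le> r p" "r p \<le> (k + 1) * b" "(k + 1) * b \<le> m" "m \<le> k' * b" "k' * b \<le> r q" "r q < n"
    using m kb range[OF pq(1)] range[OF pq(2)] by auto
  have Xm: "X a \<le> X a'" if "0 \<le> a" "a \<le> a'" "a' < n" for a a'
    unfolding X_def using coord_mono[OF fin(1), of a a'] that c by simp
  have Ym: "Y a \<le> Y a'" if "0 \<le> a" "a \<le> a'" "a' < n" for a a'
    unfolding Y_def using coord_mono[OF fin(2), of a a'] that c by simp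
  have "m = midpoint i k' * b" using i(2) by (simp add: m_def)
  then have tk: "(k + 1) * b \<in> touch g j k" "m \<in> touch g j k" "m \<in> touch g j k'" "k' * b \<in> touch g j k'"
    using i(1) m_def unfolding touch_def b_def by blast+
  have "M_connected (P \<union> Q) (X (r p), Y (h p)) (X (r q), Y (h q))"
  proof (rule M_connected_staircase[where x\<^sub>1 = "X ((k + 1) * b)" and x\<^sub>2 = "X m" and x\<^sub>3 = "X (k' * b)"
        and h = "Y u" and h' = "Y v"])
    show "X (r p) \<le> X ((k + 1) * b)" "X ((k + 1) * b) \<le> X m" "X m \<le> X (k' * b)" "X (k' * b) \<le> X (r q)"
      using ord by (auto intro!: Xm)
    show "Y (h p) \<le> Y u \<and> Y u \<le> Y v \<and> Y v \<le> Y (h q) \<or> Y u \<le> Y (h p) \<and> Y v \<le> Y u \<and> Y (h q) \<le> Y v"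
      using s uv uvr range[OF pq(1)] range[OF pq(2)] by (auto intro!: Ym)
    have "(X (r p), Y (h p)) \<in> P" "(X (r q), Y (h q)) \<in> P"
      using XY[OF pq(1), symmetric] XY[OF pq(2), symmetric] pq by auto
    moreover have "(X ((k + 1) * b), Y (h p)) \<in> Q" "(X (k' * b), Y (h q)) \<in> Q"
      using Qp Qq ord XY[OF pq(1), symmetric] XY[OF pq(2), symmetric]
      by (auto simp: X_def b_def k_def k'_def)
    moreover have "(X ((k + 1) * b), Y u) \<in> Q" "(X m, Y u) \<in> Q" "(X m, Y v) \<in> Q" "(X (k' * b), Y v) \<in> Q"
      unfolding X_def Y_def using ord uvr k0 by (auto intro!: Qe[OF ef'(1)] Qe[OF ef'(2)] tk)
    ultimately show "{(X (r p), Y (h p)), (X ((k + 1) * b), Y (h p)), (X ((k + 1) * b), Y u), (X m, Y u),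
        (X m, Y v), (X (k' * b), Y v), (X (k' * b), Y (h q)), (X (r q), Y (h q))} \<subseteq> P \<union> Q"
      by simp
  qed
  then show ?thesis using XY[OF pq(1), symmetric] XY[OF pq(2), symmetric] by simp
qed

section \<open>Counting the endpoints of demands\<close>

text \<open>The first point of the path other than \<open>p\<close> shares a row or column with
  \<open>p\<close>, which no other input point does.\<close>

lemma demand_endpoint_aligned:
  assumes P: "inj_on fst P" "inj_on snd P" and pq: "p \<in> P" "p \<noteq> q" and conn: "M_connected (P \<union> Q) p q"
  shows "\<exists>c \<in> Q. fst c = fst p \<or> snd c = snd p"
proof -
  obtain k x where x: "x 0 = p" "x k = q" "\<forall>i\<le>k. x i \<in> P \<union> Q" "\<forall>i<k. aligned (x i) (x (Suc i))"
    using conn unfolding M_connected_def by blast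
  obtain i where i: "i < k" "\<forall>i'\<le>i. \<not> x i' \<noteq> p" "x (Suc i) \<noteq> p"
    using ex_least_nat_less[of "\<lambda>i. x i \<noteq> p" k] x pq by auto
  have al: "aligned p (x (Suc i))" using x(4) i by (metis order_refl)
  have "x (Suc i) \<notin> P"
  proof
    assume "x (Suc i) \<in> P"
    with al pq P have "x (Suc i) = p" unfolding aligned_def by (metis inj_onD)
    with i(3) show False by simp
  qed
  then have "x (Suc i) \<in> Q" using x(3) i(1) by (metis Suc_leI UnE)
  then show ?thesis using al by (auto simp: aligned_def)
qed

text \<open>A point of \<open>Q\<close> is in the column of at most one input point and in the row
  of at most one.\<close>

lemma card_demand_endpoints:
  assumes P: "finite P" "inj_on fst P" "inj_on snd P" and Q: "finite Q"
    and E: "E \<subseteq> P" "\<And>p. p \<in> E \<Longrightarrow> \<exists>c \<in> Q. fst c = fst p \<or> snd c = snd p"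
  shows "card E \<le> 2 * card Q"
proof -
  define E1 where "E1 = {p \<in> E. fst p \<in> fst ` Q}"
  define E2 where "E2 = {p \<in> E. snd p \<in> snd ` Q}"
  have fin: "finite E" using P E finite_subset by blast
  have "card E1 \<le> card (fst ` Q)"
    by (rule card_inj_on_le[of fst]) (use P E Q in \<open>auto simp: E1_def intro: inj_on_subset\<close>)
  moreover have "card E2 \<le> card (snd ` Q)"
    by (rule card_inj_on_le[of snd]) (use P E Q in \<open>auto simp: E2_def intro: inj_on_subset\<close>)
  moreover have "card (fst ` Q) \<le> card Q" "card (snd ` Q) \<le> card Q" using Q by (auto intro: card_image_le)
  moreover have "E \<subseteq> E1 \<union> E2" using E by (force simp: E1_def E2_def)
  then have "card E \<le> card E1 + card E2"
    using card_mono[of "E1 \<union> E2" E] card_Un_le[of E1 E2] fin by (simp add: E1_def E2_def)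
  ultimately show ?thesis by linarith
qed

section \<open>The algorithm\<close>

definition xrank :: "(int \<times> int) list \<Rightarrow> int \<Rightarrow> int" where
  "xrank ps x = int (length (filter (\<lambda>p. fst p \<le> x) ps)) - 1"

definition yrank :: "(int \<times> int) list \<Rightarrow> int \<Rightarrow> int" where
  "yrank ps y = int (length (filter (\<lambda>p. snd p \<le> y) ps)) - 1"

text \<open>For an instance this is a permutation of 0, ..., n - 1. It serves as the index range of
  all loops and as \<open>n\<close> in unary.\<close>

definition ranks :: "(int \<times> int) list \<Rightarrow> int list" where
  "ranks ps = map (\<lambda>p. xrank ps (fst p)) ps"

text \<open>
  The value is \<open>b\<^sup>i\<close> if \<open>I\<close> lists \<open>0, \<dots>, n - 1\<close> in some order and \<open>i \<le> n\<close>. The exponent is passed in unary because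
  powers are not computable in polynomial time from a binary exponent.
\<close>

definition ipow :: "int list \<Rightarrow> int \<Rightarrow> int \<Rightarrow> int" where
  "ipow I b i = b ^ length (filter (\<lambda>a. a < i) I)"

text \<open>For an instance the test reads \<open>2 ^ (i * i) < n\<close>, which means
  \<open>i < g\<close>. So the list holds the levels, and its length is \<open>g\<close> in
  unary.\<close>

definition levels :: "int list \<Rightarrow> int list" where
  "levels I = filter (\<lambda>i. ipow I (ipow I 2 i) i < int (length I)) I"

definition width :: "int list \<Rightarrow> int \<Rightarrow> int" where
  "width I j = ipow I (2 ^ length (levels I)) j"

text \<open>Equal columns occur only in demands from a point to itself, which hold trivially.
  Exchanging endpoints is harmless because M-connectedness is symmetric.\<close>

definition oriented :: "((int \<times> int) \<times> (int \<times> int)) list \<Rightarrow> ((int \<times> int) \<times> (int \<times> int)) list" where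
  "oriented ds = map (\<lambda>d. if fst (fst d) < fst (snd d) then d else (snd d, fst d))
     (filter (\<lambda>d. fst (fst d) \<noteq> fst (snd d)) ds)"

definition base_key :: "int list \<Rightarrow> int \<Rightarrow> int \<Rightarrow> int" where
  "base_key I j a = (j * int (length I) + a div width I j) * int (length I)"

definition pair_demand :: "(int \<times> int) list \<Rightarrow> int list \<Rightarrow> (int \<times> int) \<times> (int \<times> int) \<Rightarrow> int \<Rightarrow> pair_demand" where
  "pair_demand ps I d j = (if snd (fst d) \<le> snd (snd d) then 1 else - 1,
     base_key I j (xrank ps (fst (fst d))), base_key I j (xrank ps (fst (snd d))),
     yrank ps (snd (fst d)), yrank ps (snd (snd d)))"

definition separates :: "int list \<Rightarrow> int \<Rightarrow> int \<Rightarrow> int \<Rightarrow> bool" where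
  "separates I j a b \<longleftrightarrow> a div width I j \<noteq> b div width I j \<and>
     a div width I (j + 1) = b div width I (j + 1)"

definition pair_demands :: "(int \<times> int) list \<Rightarrow> int list \<Rightarrow> ((int \<times> int) \<times> (int \<times> int)) list \<Rightarrow> pair_demand list" where
  "pair_demands ps I ds = concat (map (\<lambda>d. map (\<lambda>j. pair_demand ps I d j)
     (filter (\<lambda>j. separates I j (xrank ps (fst (fst d))) (xrank ps (fst (snd d)))) (levels I))) ds)"

definition all_keys :: "int list \<Rightarrow> int list" where
  "all_keys I = concat (map (\<lambda>j. concat (map (\<lambda>k. map (\<lambda>c.
     (j * int (length I) + k) * int (length I) + c) I) I)) (levels I))"

definition next_guess :: "int list \<Rightarrow> pair_demand list \<Rightarrow> int \<Rightarrow> int" where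
  "next_guess es ds k = (if \<forall>d \<in> set ds. served (set (final_net es ds k)) d then k else k + 1)"

definition guess :: "int list \<Rightarrow> pair_demand list \<Rightarrow> int" where
  "guess es ds = (next_guess es ds ^^ length es) 0"

text \<open>A partial inverse of the rank, given as a list with at most one entry; ranks out of
  range yield no point.\<close>

definition columns :: "(int \<times> int) list \<Rightarrow> int \<Rightarrow> int list" where
  "columns ps a = map fst (filter (\<lambda>p. xrank ps (fst p) = a) ps)"

definition rows :: "(int \<times> int) list \<Rightarrow> int \<Rightarrow> int list" where
  "rows ps c = map snd (filter (\<lambda>p. yrank ps (snd p) = c) ps)"

definition endpoint_points :: "(int \<times> int) list \<Rightarrow> int list \<Rightarrow> int \<times> int \<Rightarrow> (int \<times> int) list" where
  "endpoint_points ps I p = concat (map (\<lambda>j. concat (map (\<lambda>i.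
     map (\<lambda>x. (x, snd p)) (columns ps ((xrank ps (fst p) div width I j + i) * width I j))) [0, 1])) (levels I))"

definition touch_list :: "int list \<Rightarrow> int \<Rightarrow> int \<Rightarrow> int list" where
  "touch_list I j k = (k * width I j) # ((k + 1) * width I j) #
     map (\<lambda>i. (2 * (k div ipow I 2 (i + 1)) + 1) * ipow I 2 i * width I j) (levels I)"

text \<open>The three digits of the key are recovered by division; remainders are written with
  \<open>Div\<close>, \<open>Mul\<close> and \<open>Sub\<close>, the available primitives.\<close>

definition key_points :: "(int \<times> int) list \<Rightarrow> int list \<Rightarrow> int \<Rightarrow> (int \<times> int) list" where
  "key_points ps I e = concat (map (\<lambda>a. concat (map (\<lambda>x.
     map (\<lambda>y. (x, y)) (rows ps (e - e div int (length I) * int (length I)))) (columns ps a)))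
     (touch_list I (e div int (length I) div int (length I))
       (e div int (length I) - e div int (length I) div int (length I) * int (length I))))"

definition solution_of :: "(int \<times> int) list \<Rightarrow> int list \<Rightarrow> ((int \<times> int) \<times> (int \<times> int)) list \<Rightarrow> int list \<Rightarrow> (int \<times> int) list" where
  "solution_of ps I ds N = concat (map (\<lambda>d. endpoint_points ps I (fst d) @ endpoint_points ps I (snd d)) ds)
     @ concat (map (key_points ps I) N)"

definition small_net :: "int list \<Rightarrow> pair_demand list \<Rightarrow> int list" where
  "small_net es ds = final_net es ds (guess es ds)"

definition solution :: "(int \<times> int) list \<Rightarrow> ((int \<times> int) \<times> (int \<times> int)) list \<Rightarrow> (int \<times> int) list" where
  "solution ps ds = solution_of ps (ranks ps) (oriented ds)
     (small_net (all_keys (ranks ps)) (pair_demands ps (ranks ps) (oriented ds)))"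

text \<open>The denominators 1 are what \<open>enc_rat\<close> produces for integers.\<close>

definition algorithm ::
    "(int \<times> int) list \<times> ((int \<times> int) \<times> (int \<times> int)) list \<Rightarrow> ((int \<times> int) \<times> (int \<times> int)) list" where
  "algorithm z = map (\<lambda>p. ((fst p, 1), (snd p, 1))) (solution (fst z) (snd z))"

section \<open>Polynomial running time of the algorithm\<close>

lemma ptime_lift3:
  assumes "ptime (\<lambda>z. f (fst z) (fst (snd z)) (snd (snd z)))" "ptime a" "ptime b" "ptime c"
  shows "ptime (\<lambda>x. f (a x) (b x) (c x))"
  using ptime_comp[OF assms(1) ptime_Pair[OF assms(2) ptime_Pair[OF assms(3,4)]]] by simp

lemma ptime_lift4:
  assumes "ptime (\<lambda>z. f (fst z) (fst (snd z)) (fst (snd (snd z))) (snd (snd (snd z))))"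
    "ptime a" "ptime b" "ptime c" "ptime d"
  shows "ptime (\<lambda>x. f (a x) (b x) (c x) (d x))"
  using ptime_comp[OF assms(1) ptime_Pair[OF assms(2) ptime_Pair[OF assms(3) ptime_Pair[OF assms(4,5)]]]]
  by simp

lemma ptime_weight: "ptime (\<lambda>z. weight (fst z) (snd z))"
  unfolding weight_def by (intro ptime_intros)
lemmas [ptime_intros] = ptime_lift2[OF ptime_weight]

lemma ptime_total_weight: "ptime (\<lambda>z. total_weight (fst z) (snd z))"
  unfolding total_weight_def by (intro ptime_intros)
lemmas [ptime_intros] = ptime_lift2[OF ptime_total_weight]

lemma ptime_cumul: "ptime (\<lambda>z. cumul (fst z) (fst (snd z)) (snd (snd z)))"
  unfolding cumul_def by (intro ptime_intros)
lemmas [ptime_intros] = ptime_lift3[OF ptime_cumul]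

lemma ptime_quantile: "ptime (\<lambda>z. quantile (fst z) (fst (snd z)) (fst (snd (snd z))) (snd (snd (snd z))))"
  unfolding quantile_def by (intro ptime_intros)
lemmas [ptime_intros] = ptime_lift4[OF ptime_quantile]

lemma ptime_net: "ptime (\<lambda>z. net (fst z) (fst (snd z)) (snd (snd z)))"
  unfolding net_def by (intro ptime_intros)
lemmas [ptime_intros] = ptime_lift3[OF ptime_net]

lemma ptime_served: "ptime (\<lambda>z. served (set (fst z)) (snd z))"
  unfolding served_def case_prod_beta by (intro ptime_intros)
lemmas [ptime_intros] = ptime_lift2[where f = "\<lambda>N. served (set N)", OF ptime_served]

lemma ptime_gap: "ptime (\<lambda>z. gap (fst z) (fst (snd z)) (snd (snd z)))"
  unfolding gap_def start_gap_def end_gap_def case_prod_beta by (intro ptime_intros)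
lemmas [ptime_intros] = ptime_lift3[OF ptime_gap]

lemma ptime_reweight: "ptime (\<lambda>z. reweight (fst z) (fst (snd z)) (fst (snd (snd z))) (snd (snd (snd z))))"
  unfolding reweight_def by (intro ptime_intros)

lemma ptime_rounds: "ptime rounds"
  unfolding rounds_def by (intro ptime_intros)

lemma ptime_final_net: "ptime (\<lambda>z. final_net (fst z) (fst (snd z)) (snd (snd z)))"
proof -
  have "ptime (\<lambda>z. (reweight (fst z) (fst (snd z)) (snd (snd z)) ^^ length (rounds (fst z))) [])"
  proof (rule ptime_funpow)
    show "poly_bounded (\<lambda>z :: int list \<times> pair_demand list \<times> int. 1 + esize (fst z))"
      by (intro poly_bounded_add poly_bounded_const ptime_size ptime_intros)
    \<comment> \<open>A round adds at most one sublist of \<open>es\<close>, whatever the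
      history.\<close>
    show "esize (reweight (fst x) (fst (snd x)) (snd (snd x)) s) \<le> esize s + (1 + esize (fst x))" for x s
      unfolding reweight_def gap_def by (auto split: list.split intro: le_SucI esize_filter)
  qed (intro ptime_intros ptime_lift4[OF ptime_reweight] ptime_comp[OF ptime_rounds])+
  then show ?thesis unfolding final_net_def by (intro ptime_intros)
qed
lemmas [ptime_intros] = ptime_lift3[OF ptime_final_net]

lemma ptime_next_guess: "ptime (\<lambda>z. next_guess (fst z) (fst (snd z)) (snd (snd z)))"
  unfolding next_guess_def by (intro ptime_intros)

lemma ptime_guess: "ptime (\<lambda>z. guess (fst z) (snd z))"
  unfolding guess_def
proof (rule ptime_funpow)
  show "poly_bounded (\<lambda>z :: int list \<times> pair_demand list. esize (1 :: int))"
    by (rule poly_bounded_const)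
  show "esize (next_guess (fst x) (snd x) s) \<le> esize s + esize (1 :: int)" for x s
    unfolding next_guess_def using esize_add[of s 1] by auto
qed (intro ptime_intros ptime_lift3[OF ptime_next_guess])+
lemmas [ptime_intros] = ptime_lift2[OF ptime_guess]

lemma ptime_small_net: "ptime (\<lambda>z. small_net (fst z) (snd z))"
  unfolding small_net_def by (intro ptime_intros)
lemmas [ptime_intros] = ptime_lift2[OF ptime_small_net]

lemma ptime_xrank: "ptime (\<lambda>z. xrank (fst z) (snd z))"
  unfolding xrank_def by (intro ptime_intros)
lemmas [ptime_intros] = ptime_lift2[OF ptime_xrank]

lemma ptime_yrank: "ptime (\<lambda>z. yrank (fst z) (snd z))"
  unfolding yrank_def by (intro ptime_intros)
lemmas [ptime_intros] = ptime_lift2[OF ptime_yrank]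

lemma ptime_ranks: "ptime ranks"
  unfolding ranks_def by (intro ptime_intros)
lemmas [ptime_intros] = ptime_comp[OF ptime_ranks]

lemma ptime_ipow: "ptime (\<lambda>z. ipow (fst z) (fst (snd z)) (snd (snd z)))"
  unfolding ipow_def by (intro ptime_intros)
lemmas [ptime_intros] = ptime_lift3[OF ptime_ipow]

lemma ptime_levels: "ptime levels"
  unfolding levels_def by (intro ptime_intros)
lemmas [ptime_intros] = ptime_comp[OF ptime_levels]

lemma ptime_width: "ptime (\<lambda>z. width (fst z) (snd z))"
  unfolding width_def by (intro ptime_intros)
lemmas [ptime_intros] = ptime_lift2[OF ptime_width]

lemma ptime_oriented: "ptime oriented"
  unfolding oriented_def by (intro ptime_intros)
lemmas [ptime_intros] = ptime_comp[OF ptime_oriented]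

lemma ptime_base_key: "ptime (\<lambda>z. base_key (fst z) (fst (snd z)) (snd (snd z)))"
  unfolding base_key_def by (intro ptime_intros)
lemmas [ptime_intros] = ptime_lift3[OF ptime_base_key]

lemma ptime_pair_demand:
  "ptime (\<lambda>z. pair_demand (fst z) (fst (snd z)) (fst (snd (snd z))) (snd (snd (snd z))))"
  unfolding pair_demand_def by (intro ptime_intros)
lemmas [ptime_intros] = ptime_lift4[OF ptime_pair_demand]

lemma ptime_separates:
  "ptime (\<lambda>z. separates (fst z) (fst (snd z)) (fst (snd (snd z))) (snd (snd (snd z))))"
  unfolding separates_def by (intro ptime_intros)
lemmas [ptime_intros] = ptime_lift4[OF ptime_separates]

lemma ptime_pair_demands: "ptime (\<lambda>z. pair_demands (fst z) (fst (snd z)) (snd (snd z)))"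
  unfolding pair_demands_def by (intro ptime_intros)
lemmas [ptime_intros] = ptime_lift3[OF ptime_pair_demands]

lemma ptime_all_keys: "ptime all_keys"
  unfolding all_keys_def by (intro ptime_intros)
lemmas [ptime_intros] = ptime_comp[OF ptime_all_keys]

lemma ptime_columns: "ptime (\<lambda>z. columns (fst z) (snd z))"
  unfolding columns_def by (intro ptime_intros)
lemmas [ptime_intros] = ptime_lift2[OF ptime_columns]

lemma ptime_rows: "ptime (\<lambda>z. rows (fst z) (snd z))"
  unfolding rows_def by (intro ptime_intros)
lemmas [ptime_intros] = ptime_lift2[OF ptime_rows]

lemma ptime_endpoint_points: "ptime (\<lambda>z. endpoint_points (fst z) (fst (snd z)) (snd (snd z)))"
  unfolding endpoint_points_def by (intro ptime_intros)
lemmas [ptime_intros] = ptime_lift3[OF ptime_endpoint_points]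

lemma ptime_touch_list: "ptime (\<lambda>z. touch_list (fst z) (fst (snd z)) (snd (snd z)))"
  unfolding touch_list_def by (intro ptime_intros)
lemmas [ptime_intros] = ptime_lift3[OF ptime_touch_list]

lemma ptime_key_points: "ptime (\<lambda>z. key_points (fst z) (fst (snd z)) (snd (snd z)))"
  unfolding key_points_def by (intro ptime_intros)
lemmas [ptime_intros] = ptime_lift3[OF ptime_key_points]

lemma ptime_solution_of:
  "ptime (\<lambda>z. solution_of (fst z) (fst (snd z)) (fst (snd (snd z))) (snd (snd (snd z))))"
  unfolding solution_of_def by (intro ptime_intros)
lemmas [ptime_intros] = ptime_lift4[OF ptime_solution_of]

lemma ptime_algorithm: "ptime algorithm"
  unfolding algorithm_def solution_def by (intro ptime_intros)

section \<open>Correctness of the algorithm\<close>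

text \<open>The guess \<open>card A\<close> succeeds, and the counter moves in unit steps and stops
  at the first success, so it never passes \<open>card A\<close>. Since \<open>card A\<close> is at
  most the number of rounds, it ends at a successful guess. No monotonicity in the guess is
  used.\<close>

lemma guess_spec:
  assumes A: "finite A" "A \<subseteq> set es"
    and sat: "\<And>d. d \<in> set ds \<Longrightarrow> served A d \<and> (fst d = 1 \<or> fst d = - 1)"
  shows "0 \<le> guess es ds" "guess es ds \<le> card A"
    "\<And>d. d \<in> set ds \<Longrightarrow> served (set (small_net es ds)) d"
proof -
  define ok where "ok k \<longleftrightarrow> (\<forall>d \<in> set ds. served (set (final_net es ds k)) d)" for k
  define v where "v i = (next_guess es ds ^^ i) 0" for i
  have okA: "ok (int (card A))" using final_net_serves[OF A refl sat] by (simp add: ok_def)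
  have v: "0 \<le> v i \<and> v i \<le> card A \<and> (ok (v i) \<or> v i = i)" for i
  proof (induction i)
    case (Suc i)
    have "v (Suc i) = (if ok (v i) then v i else v i + 1)"
      by (simp add: v_def next_guess_def ok_def)
    moreover have "v i \<noteq> card A" if "\<not> ok (v i)" using that okA by metis
    ultimately show ?case using Suc by auto
  qed (simp add: v_def)
  have g: "guess es ds = v (length es)" by (simp add: guess_def v_def)
  show "0 \<le> guess es ds" "guess es ds \<le> card A" using v[of "length es"] by (simp_all add: g)
  have "card A \<le> length es"
    using card_mono[OF _ A(2)] card_length[of es] by simp
  then have "ok (guess es ds)" using v[of "length es"] okA unfolding g
    by (metis le_antisym of_nat_le_iff)
  then show "served (set (small_net es ds)) d" if "d \<in> set ds" for d
    using that by (simp add: ok_def small_net_def)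
qed

text \<open>Guarantees that the minimum in \<open>opt\<close> is attained; each demand turns once,
  at a grid point.\<close>

lemma grid_feasible:
  assumes "finite P" "D \<subseteq> P \<times> P" shows "feasible P D (fst ` P \<times> snd ` P)"
proof -
  have "M_connected (P \<union> fst ` P \<times> snd ` P) p q" if "p \<in> P" "q \<in> P" for p q
  proof (rule M_connected_step[where r = "(fst q, snd p)"])
    show "M_connected (P \<union> fst ` P \<times> snd ` P) (fst q, snd p) q"
      by (rule M_connected_step[OF _ _ _ M_connected_refl]) (use that in \<open>auto simp: aligned_def l1_dist_def\<close>)
  qed (use that in \<open>auto simp: aligned_def l1_dist_def\<close>)
  then show ?thesis using assms by (auto simp: feasible_def)
qed

section \<open>The number of levels\<close>

definition grid_size :: "nat \<Rightarrow> nat" where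
  "grid_size n = (LEAST g. n \<le> 2 ^ (g * g))"

lemma le_two_power_square: "n \<le> (2::nat) ^ (n * n)"
  by (meson le_square less_exp less_imp_le one_le_numeral order_trans power_increasing)

lemma grid_size_ge: "n \<le> 2 ^ (grid_size n * grid_size n)"
  unfolding grid_size_def by (rule LeastI[of _ n]) (rule le_two_power_square)

lemma less_grid_size_iff: "i < grid_size n \<longleftrightarrow> 2 ^ (i * i) < n"
proof
  show "2 ^ (i * i) < n" if "i < grid_size n"
    using not_less_Least[of i "\<lambda>g. n \<le> 2 ^ (g * g)"] that by (simp add: grid_size_def)
  show "i < grid_size n" if "2 ^ (i * i) < n"
  proof (rule ccontr)
    assume "\<not> i < grid_size n"
    then have "grid_size n * grid_size n \<le> i * i" by (intro mult_mono) auto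
    then have "(2::nat) ^ (grid_size n * grid_size n) \<le> 2 ^ (i * i)" by (intro power_increasing) auto
    with that grid_size_ge[of n] show False by simp
  qed
qed

text \<open>Keeps all exponents within the range on which \<open>ipow\<close> computes
  powers.\<close>

lemma grid_size_le: "grid_size n \<le> n"
  unfolding grid_size_def by (rule Least_le) (rule le_two_power_square)

lemma bex_int_lessThan: "(\<exists>j \<in> {0..<int m}. Q j) \<longleftrightarrow> (\<exists>j<m. Q (int j))"
proof -
  have "{0..<int m} = int ` {..<m}"
    by (simp add: image_int_atLeastLessThan lessThan_atLeast0)
  then show ?thesis by (simp only: bex_simps Bex_def lessThan_iff image_iff) blast
qed

lemma fst_int_point: "fst (int_point p) = of_int (fst p)" and snd_int_point: "snd (int_point p) = of_int (snd p)"
  by (simp_all add: int_point_def)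

lemma inj_int_point: "inj_on int_point A"
  by (auto simp: inj_on_def int_point_def)

lemma inj_on_fst_int_point: assumes "inj_on fst (int_point ` S)" shows "inj_on fst S"
proof (rule inj_onI)
  fix p q assume pq: "p \<in> S" "q \<in> S" "fst p = fst q"
  then have "int_point p = int_point q" by (intro inj_onD[OF assms]) (simp_all add: fst_int_point)
  then show "p = q" by (rule injD[OF inj_int_point])
qed

lemma inj_on_snd_int_point: assumes "inj_on snd (int_point ` S)" shows "inj_on snd S"
proof (rule inj_onI)
  fix p q assume pq: "p \<in> S" "q \<in> S" "snd p = snd q"
  then have "int_point p = int_point q" by (intro inj_onD[OF assms]) (simp_all add: snd_int_point)
  then show "p = q" by (rule injD[OF inj_int_point])
qed

section \<open>The list functions on an instance\<close>

locale point_list =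
  fixes ps :: "(int \<times> int) list"
  assumes distinct: "distinct ps" and inj_fst: "inj_on fst (set ps)" and inj_snd: "inj_on snd (set ps)"
begin

abbreviation P :: "point set" where "P \<equiv> int_point ` set ps"
abbreviation n :: int where "n \<equiv> int (length ps)"
abbreviation G :: nat where "G \<equiv> grid_size (length ps)"

lemma P: "finite P" "inj_on fst P" "inj_on snd P" "card P = length ps"
  using inj_fst inj_snd distinct_card[OF distinct] card_image[OF inj_int_point]
  by (auto simp: inj_on_def fst_int_point snd_int_point)

lemma card_coords: "card (fst ` P) = length ps" "card (snd ` P) = length ps"
  using P by (simp_all add: card_image)

lemma xrank_eq: "xrank ps x = rank (fst ` P) (of_int x)"
proof -
  have "{s \<in> fst ` P. s \<le> of_int x} = (\<lambda>p. real_of_int (fst p)) ` set (filter (\<lambda>p. fst p \<le> x) ps)"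
    by (auto simp: fst_int_point image_iff)
  moreover have "inj_on (\<lambda>p. real_of_int (fst p)) (set (filter (\<lambda>p. fst p \<le> x) ps))"
    using inj_fst by (auto simp: inj_on_def)
  ultimately show ?thesis
    unfolding xrank_def rank_def using distinct_card[OF distinct_filter[OF distinct]] by (simp add: card_image)
qed

lemma yrank_eq: "yrank ps y = rank (snd ` P) (of_int y)"
proof -
  have "{s \<in> snd ` P. s \<le> of_int y} = (\<lambda>p. real_of_int (snd p)) ` set (filter (\<lambda>p. snd p \<le> y) ps)"
    by (auto simp: snd_int_point image_iff)
  moreover have "inj_on (\<lambda>p. real_of_int (snd p)) (set (filter (\<lambda>p. snd p \<le> y) ps))"
    using inj_snd by (auto simp: inj_on_def)
  ultimately show ?thesis
    unfolding yrank_def rank_def using distinct_card[OF distinct_filter[OF distinct]] by (simp add: card_image)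
qed

abbreviation I :: "int list" where "I \<equiv> ranks ps"

lemma ranks_props: "length I = length ps" "set I = {0..<n}" "distinct I"
proof -
  show len: "length I = length ps" by (simp add: ranks_def)
  have "set I = rank (fst ` P) ` fst ` P"
    by (simp add: ranks_def xrank_eq image_image fst_int_point)
  also have "\<dots> = {0..<n}" using rank_bij[of "fst ` P"] card_coords by (simp add: bij_betw_def)
  finally show "set I = {0..<n}" .
  then show "distinct I" using len by (intro card_distinct) simp
qed

lemma ipow_eq: assumes "0 \<le> i" "i \<le> n" shows "ipow I b i = b ^ nat i"
proof -
  have "length (filter (\<lambda>a. a < i) I) = card (set (filter (\<lambda>a. a < i) I))"
    by (rule distinct_card[symmetric]) (simp add: ranks_props)
  also have "set (filter (\<lambda>a. a < i) I) = {0..<i}" using assms by (auto simp: ranks_props)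
  finally show ?thesis by (simp add: ipow_def)
qed

lemma levels_props: "set (levels I) = {0..<int G}" "length (levels I) = G"
proof -
  have "ipow I (ipow I 2 (int i)) (int i) < n \<longleftrightarrow> i < G" if "i < length ps" for i
  proof -
    have "ipow I (ipow I 2 (int i)) (int i) = int (2 ^ (i * i))"
      using that by (simp add: ipow_eq power_mult)
    then show ?thesis unfolding less_grid_size_iff by (simp only: of_nat_less_iff)
  qed
  then have "ipow I (ipow I 2 i) i < n \<longleftrightarrow> i < int G" if "0 \<le> i" "i < n" for i
    using that by (metis nonneg_int_cases of_nat_less_iff)
  then show *: "set (levels I) = {0..<int G}"
    using grid_size_le[of "length ps"] by (auto simp: levels_def ranks_props)
  have "distinct (levels I)" by (simp add: levels_def ranks_props)
  from distinct_card[OF this] show "length (levels I) = G" by (simp add: *)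
qed

lemma width_eq: "j \<le> G \<Longrightarrow> width I (int j) = 2 ^ (G * j)"
  using grid_size_le[of "length ps"] by (simp add: width_def levels_props ipow_eq power_mult)

lemma div_width: "j \<le> G \<Longrightarrow> a div width I (int j) = slab G j a"
  by (simp add: width_eq slab_def)

lemma set_all_keys: "set (all_keys I) = valid_keys G n"
proof -
  have "e \<in> set (all_keys I) \<longleftrightarrow> (\<exists>j \<in> {0..<int G}. \<exists>k \<in> {0..<n}. \<exists>c \<in> {0..<n}. e = (j * n + k) * n + c)" for e
    by (simp only: all_keys_def set_concat set_map image_image levels_props ranks_props UN_iff image_iff)
  then have "e \<in> set (all_keys I) \<longleftrightarrow> (\<exists>j<G. \<exists>k \<in> {0..<n}. \<exists>c \<in> {0..<n}. e = (int j * n + k) * n + c)" for e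
    unfolding bex_int_lessThan .
  then show ?thesis unfolding valid_keys_def key_def by (auto simp: set_eq_iff Bex_def)
qed

lemma base_key_eq: "j \<le> G \<Longrightarrow> base_key I (int j) a = key n j (slab G j a) 0"
  by (simp add: base_key_def div_width key_def ranks_props)

lemma separates_eq: "j < G \<Longrightarrow> separates I (int j) a b \<longleftrightarrow> separated G j a b"
  using div_width[of "Suc j"] by (simp add: separates_def separated_def div_width add.commute)

text \<open>Uniqueness is stated through \<open>hd\<close>, so that point lists can be counted as
  images of index lists.\<close>

lemma columns_props:
  "0 \<le> a \<Longrightarrow> a < n \<Longrightarrow> \<exists>x \<in> set (columns ps a). real_of_int x = coord (fst ` P) a"
  "x \<in> set (columns ps a) \<Longrightarrow> x = hd (columns ps a)"
proof -
  assume "0 \<le> a" "a < n"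
  then have "coord (fst ` P) a \<in> fst ` P" "rank (fst ` P) (coord (fst ` P) a) = a"
    by (auto intro!: coord_in rank_coord simp: card_coords)
  then obtain p where p: "p \<in> set ps" "coord (fst ` P) a = of_int (fst p)" "xrank ps (fst p) = a"
    by (auto simp: fst_int_point xrank_eq)
  then show "\<exists>x \<in> set (columns ps a). real_of_int x = coord (fst ` P) a"
    by (auto simp: columns_def)
next
  have "real_of_int x = coord (fst ` P) a" if "x \<in> set (columns ps a)" for x
  proof -
    from that obtain p where p: "p \<in> set ps" "x = fst p" "xrank ps x = a" by (auto simp: columns_def)
    then have "real_of_int x \<in> fst ` P" by (force simp: fst_int_point)
    then show ?thesis using coord_rank[of "fst ` P" "real_of_int x"] p by (simp add: xrank_eq)
  qed
  then show "x = hd (columns ps a)" if "x \<in> set (columns ps a)"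
    using that by (metis list.set_sel(1) empty_iff empty_set of_int_eq_iff)
qed

lemma rows_props:
  "0 \<le> c \<Longrightarrow> c < n \<Longrightarrow> \<exists>y \<in> set (rows ps c). real_of_int y = coord (snd ` P) c"
  "y \<in> set (rows ps c) \<Longrightarrow> y = hd (rows ps c)"
proof -
  assume "0 \<le> c" "c < n"
  then have "coord (snd ` P) c \<in> snd ` P" "rank (snd ` P) (coord (snd ` P) c) = c"
    by (auto intro!: coord_in rank_coord simp: card_coords)
  then obtain p where p: "p \<in> set ps" "coord (snd ` P) c = of_int (snd p)" "yrank ps (snd p) = c"
    by (auto simp: snd_int_point yrank_eq)
  then show "\<exists>y \<in> set (rows ps c). real_of_int y = coord (snd ` P) c"
    by (auto simp: rows_def)
next
  have "real_of_int y = coord (snd ` P) c" if "y \<in> set (rows ps c)" for y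
  proof -
    from that obtain p where p: "p \<in> set ps" "y = snd p" "yrank ps y = c" by (auto simp: rows_def)
    then have "real_of_int y \<in> snd ` P" by (force simp: snd_int_point)
    then show ?thesis using coord_rank[of "snd ` P" "real_of_int y"] p by (simp add: yrank_eq)
  qed
  then show "y = hd (rows ps c)" if "y \<in> set (rows ps c)"
    using that by (metis list.set_sel(1) empty_iff empty_set of_int_eq_iff)
qed

lemma set_touch_list: "j < G \<Longrightarrow> set (touch_list I (int j) k) = touch G j k"
proof -
  assume j: "j < G"
  have "(2 * (k div ipow I 2 (int i + 1)) + 1) * ipow I 2 (int i) * width I (int j) = midpoint i k * 2 ^ (G * j)"
    if "i < G" for i
  proof -
    have "ipow I 2 (int i + 1) = 2 ^ Suc i"
      using that grid_size_le[of "length ps"] by (simp add: ipow_eq nat_add_distrib)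
    then show ?thesis using that j grid_size_le[of "length ps"]
      by (simp add: ipow_eq midpoint_def width_eq)
  qed
  moreover have "{0..<int G} = int ` {..<G}"
    by (simp add: image_int_atLeastLessThan lessThan_atLeast0)
  ultimately show ?thesis using j
    by (auto simp: touch_list_def touch_def levels_props width_eq image_iff)
qed

lemma key_points_mem:
  assumes j: "j < G" and k: "0 \<le> k" "k < n" and c: "0 \<le> c" "c < n" and t: "t \<in> touch G j k" "0 \<le> t" "t < n"
  shows "(coord (fst ` P) t, coord (snd ` P) c) \<in> int_point ` set (key_points ps I (key n j k c))"
proof -
  define e where "e = key n j k c"
  have e1: "e div n = int j * n + k"
    using c by (intro int_div_pos_eq[where r = c]) (auto simp: e_def key_def)
  have e2: "e div n div n = int j"
    unfolding e1 using k by (intro int_div_pos_eq[where r = k]) auto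
  have "e div n div n = int j" "e div n - e div n div n * n = k" "e - e div n * n = c"
    unfolding e2 unfolding e1 by (simp_all add: e_def key_def)
  moreover obtain x where "x \<in> set (columns ps t)" "real_of_int x = coord (fst ` P) t"
    using columns_props(1)[OF t(2,3)] by blast
  moreover obtain y where "y \<in> set (rows ps c)" "real_of_int y = coord (snd ` P) c"
    using rows_props(1)[OF c] by blast
  ultimately have "(x, y) \<in> set (key_points ps I e)"
    using t(1) by (auto simp: key_points_def ranks_props set_touch_list[OF j])
  then have "int_point (x, y) \<in> int_point ` set (key_points ps I e)" by blast
  then show ?thesis using \<open>real_of_int x = _\<close> \<open>real_of_int y = _\<close> by (simp add: int_point_def e_def)
qed

lemma endpoint_points_mem:
  assumes j: "j < G" and i: "i = 0 \<or> i = 1"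
    and t: "t = (slab G j (xrank ps (fst p)) + i) * 2 ^ (G * j)" "0 \<le> t" "t < n"
  shows "(coord (fst ` P) t, of_int (snd p)) \<in> int_point ` set (endpoint_points ps I p)"
proof -
  obtain x where x: "x \<in> set (columns ps t)" "real_of_int x = coord (fst ` P) t"
    using columns_props(1)[OF t(2,3)] by blast
  have "int j \<in> set (levels I)" using j by (simp add: levels_props)
  moreover have "t = (xrank ps (fst p) div width I (int j) + i) * width I (int j)"
    using j t(1) by (simp add: slab_def width_eq)
  ultimately have "(x, snd p) \<in> set (endpoint_points ps I p)"
    using x(1) i unfolding endpoint_points_def by fastforce
  then have "int_point (x, snd p) \<in> int_point ` set (endpoint_points ps I p)" by blast
  then show ?thesis using x(2) by (simp add: int_point_def)
qed

lemma card_key_points: "card (set (key_points ps I e)) \<le> G + 2"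
proof -
  define c where "c = e - e div int (length I) * int (length I)"
  define T where "T = touch_list I (e div int (length I) div int (length I))
       (e div int (length I) - e div int (length I) div int (length I) * int (length I))"
  have "set (key_points ps I e) \<subseteq> (\<lambda>a. (hd (columns ps a), hd (rows ps c))) ` set T"
    using columns_props(2) rows_props(2) by (fastforce simp: key_points_def c_def T_def)
  then have "card (set (key_points ps I e)) \<le> card (set T)"
    by (rule surj_card_le[rotated]) simp
  also have "\<dots> \<le> length T" by (rule card_length)
  also have "\<dots> = G + 2" by (simp add: T_def touch_list_def levels_props)
  finally show ?thesis .
qed

lemma card_endpoint_points: "card (set (endpoint_points ps I p)) \<le> 2 * G"
proof -
  define f where "f = (\<lambda>(j, i). (hd (columns ps ((xrank ps (fst p) div width I j + i) * width I j)), snd p))"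
  have "set (endpoint_points ps I p) \<subseteq> f ` ({0..<int G} \<times> {0, 1})"
  proof
    fix z assume "z \<in> set (endpoint_points ps I p)"
    then have "\<exists>j \<in> {0..<int G}. \<exists>i \<in> {0, 1}.
        \<exists>x \<in> set (columns ps ((xrank ps (fst p) div width I j + i) * width I j)). z = (x, snd p)"
      by (simp only: endpoint_points_def set_concat set_map image_image levels_props list.set UN_iff image_iff)
    then obtain j i x where z: "j \<in> {0..<int G}" "i \<in> {0, 1}" "z = (x, snd p)"
      "x \<in> set (columns ps ((xrank ps (fst p) div width I j + i) * width I j))" by blast
    have "z = f (j, i)" unfolding f_def z(3) prod.case using columns_props(2)[OF z(4)] by (rule arg_cong)
    moreover have "(j, i) \<in> {0..<int G} \<times> {0, 1}" using z(1,2) by blast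
    ultimately show "z \<in> f ` ({0..<int G} \<times> {0, 1})" by (rule image_eqI)
  qed
  then have "card (set (endpoint_points ps I p)) \<le> card ({0..<int G} \<times> {0, 1 :: int})"
    by (rule surj_card_le[rotated]) simp
  then show ?thesis by (simp add: card_cartesian_product)
qed

lemma pair_demands_iff:
  "t \<in> set (pair_demands ps I ds) \<longleftrightarrow> (\<exists>d \<in> set ds. \<exists>j<G.
     separated G j (xrank ps (fst (fst d))) (xrank ps (fst (snd d))) \<and> t = pair_demand ps I d (int j))"
proof -
  have "t \<in> set (pair_demands ps I ds) \<longleftrightarrow> (\<exists>d \<in> set ds. \<exists>j \<in> {0..<int G}.
     separates I j (xrank ps (fst (fst d))) (xrank ps (fst (snd d))) \<and> t = pair_demand ps I d j)"
    by (simp only: pair_demands_def set_concat set_map image_image set_filter levels_props UN_iff image_iff) blast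
  then show ?thesis unfolding bex_int_lessThan by (simp add: separates_eq cong: conj_cong)
qed

lemma oriented_separated:
  assumes "p \<in> set ps" "q \<in> set ps" "fst p < fst q"
  shows "\<exists>j<G. separated G j (xrank ps (fst p)) (xrank ps (fst q))"
proof (rule separated_exists)
  have "xrank ps (fst p) < xrank ps (fst q)"
    using assms unfolding xrank_eq by (intro rank_strict_mono) (auto simp: fst_int_point image_iff)
  then show "xrank ps (fst p) \<noteq> xrank ps (fst q)" by simp
  have "0 \<le> xrank ps (fst z) \<and> xrank ps (fst z) < n" if "z \<in> set ps" for z
    using ranks_props(2) that by (force simp: ranks_def)
  moreover have "n \<le> 2 ^ (G * G)" using grid_size_ge[of "length ps"]
    by (metis of_nat_le_iff of_nat_numeral of_nat_power)
  ultimately show "0 \<le> xrank ps (fst p)" "0 \<le> xrank ps (fst q)" "xrank ps (fst p) < 2 ^ (G * G)"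
    "xrank ps (fst q) < 2 ^ (G * G)"
    using assms by (meson order_less_le_trans)+
qed

lemma pair_demand_eq:
  assumes "j < G"
  shows "pair_demand ps I d (int j) = (if snd (fst d) \<le> snd (snd d) then 1 else - 1,
     key (card P) j (slab G j (rank (fst ` P) (fst (int_point (fst d))))) 0,
     key (card P) j (slab G j (rank (fst ` P) (fst (int_point (snd d))))) 0,
     rank (snd ` P) (snd (int_point (fst d))), rank (snd ` P) (snd (int_point (snd d))))"
  using assms by (simp add: pair_demand_def base_key_eq xrank_eq yrank_eq fst_int_point snd_int_point P(4))

lemma solution_of_connects:
  assumes ds: "d \<in> set ds" "fst d \<in> set ps" "snd d \<in> set ps" "fst (fst d) < fst (snd d)"
    and N: "\<And>t. t \<in> set (pair_demands ps I ds) \<Longrightarrow> served (set N) t"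
  shows "M_connected (P \<union> int_point ` set (solution_of ps I ds N)) (int_point (fst d)) (int_point (snd d))"
proof -
  obtain j where j: "j < G" "separated G j (xrank ps (fst (fst d))) (xrank ps (fst (snd d)))"
    using oriented_separated[OF ds(2-4)] by blast
  let ?Q = "int_point ` set (solution_of ps I ds N)"
  have sub: "int_point ` set (endpoint_points ps I (fst d)) \<subseteq> ?Q"
    "int_point ` set (endpoint_points ps I (snd d)) \<subseteq> ?Q"
    using ds(1) by (auto simp: solution_of_def)
  have rng: "0 \<le> xrank ps (fst z)" "xrank ps (fst z) < n" if "z \<in> set ps" for z
    using ranks_props(2) that by (force simp: ranks_def)+
  have slab0: "0 \<le> slab G j (xrank ps (fst z))" if "z \<in> set ps" for z
    using rng(1)[OF that] by (simp add: slab_def pos_imp_zdiv_nonneg_iff)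
  \<comment> \<open>The left boundary of a slab does not exceed any rank in it and so is a valid
    column. The right boundary may be out of range.\<close>
  have slab1: "slab G j (xrank ps (fst z)) * 2 ^ (G * j) < n" if "z \<in> set ps" for z
  proof -
    have "slab G j (xrank ps (fst z)) * 2 ^ (G * j) \<le> xrank ps (fst z)"
      unfolding slab_def minus_mod_eq_div_mult[symmetric] by simp
    then show ?thesis using rng(2)[OF that] by simp
  qed
  show ?thesis
  proof (rule served_connected[where g = G and j = j and N = "set N"
        and s = "if snd (fst d) \<le> snd (snd d) then 1 else - 1"])
    show "finite P" "inj_on fst P" "inj_on snd P" by (rule P)+
    show "int_point (fst d) \<in> P" "int_point (snd d) \<in> P" using ds by auto
    show "fst (int_point (fst d)) < fst (int_point (snd d))" using ds by (simp add: fst_int_point)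
    show "separated G j (rank (fst ` P) (fst (int_point (fst d)))) (rank (fst ` P) (fst (int_point (snd d))))"
      using j by (simp add: fst_int_point xrank_eq)
    have "served (set N) (pair_demand ps I d (int j))" using j ds(1) by (intro N) (auto simp: pair_demands_iff)
    then show "served (set N) (if snd (fst d) \<le> snd (snd d) then 1 else - 1,
     key (card P) j (slab G j (rank (fst ` P) (fst (int_point (fst d))))) 0,
     key (card P) j (slab G j (rank (fst ` P) (fst (int_point (snd d))))) 0,
     rank (snd ` P) (snd (int_point (fst d))), rank (snd ` P) (snd (int_point (snd d))))"
      by (simp only: pair_demand_eq[OF j(1)])
    show "(coord (fst ` P) ((slab G j (rank (fst ` P) (fst (int_point (fst d)))) + 1) * 2 ^ (G * j)),
        snd (int_point (fst d))) \<in> ?Q"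
      if "(slab G j (rank (fst ` P) (fst (int_point (fst d)))) + 1) * 2 ^ (G * j) < int (card P)"
      using endpoint_points_mem[OF j(1), of 1 _ "fst d"] that slab0[OF ds(2)] sub(1) P(4)
      by (auto simp: fst_int_point snd_int_point xrank_eq)
    show "(coord (fst ` P) (slab G j (rank (fst ` P) (fst (int_point (snd d)))) * 2 ^ (G * j)),
        snd (int_point (snd d))) \<in> ?Q"
      using endpoint_points_mem[OF j(1), of 0 _ "snd d"] slab0[OF ds(3)] slab1[OF ds(3)] sub(2)
      by (auto simp: fst_int_point snd_int_point xrank_eq)
    show "(coord (fst ` P) t, coord (snd ` P) c) \<in> ?Q"
      if "key (card P) j k c \<in> set N" "0 \<le> k" "k < int (card P)" "0 \<le> c" "c < int (card P)"
        "t \<in> touch G j k" "0 \<le> t" "t < int (card P)" for k c t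
    proof -
      have "(coord (fst ` P) t, coord (snd ` P) c) \<in> int_point ` set (key_points ps I (key n j k c))"
        using that j(1) unfolding P(4) by (intro key_points_mem)
      then show ?thesis using that(1) unfolding P(4) by (auto simp: solution_of_def)
    qed
  qed auto
qed

lemma card_solution_of:
  "card (set (solution_of ps I ds N)) \<le> 2 * G * card (fst ` set ds \<union> snd ` set ds) + (G + 2) * card (set N)"
proof -
  let ?E = "fst ` set ds \<union> snd ` set ds"
  have "set (solution_of ps I ds N) = (\<Union>p\<in>?E. set (endpoint_points ps I p)) \<union> (\<Union>e\<in>set N. set (key_points ps I e))"
    by (auto simp: solution_of_def)
  then have "card (set (solution_of ps I ds N)) \<le> card (\<Union>p\<in>?E. set (endpoint_points ps I p))
      + card (\<Union>e\<in>set N. set (key_points ps I e))"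
    by (simp only: card_Un_le)
  also have "card (\<Union>p\<in>?E. set (endpoint_points ps I p)) \<le> (\<Sum>p\<in>?E. card (set (endpoint_points ps I p)))"
    by (rule card_UN_le) simp
  also have "\<dots> \<le> (\<Sum>p\<in>?E. 2 * G)" by (intro sum_mono card_endpoint_points)
  also have "card (\<Union>e\<in>set N. set (key_points ps I e)) \<le> (\<Sum>e\<in>set N. card (set (key_points ps I e)))"
    by (rule card_UN_le) simp
  also have "\<dots> \<le> (\<Sum>e\<in>set N. G + 2)" by (intro sum_mono card_key_points)
  finally show ?thesis by (simp add: mult.commute)
qed

lemma oriented_props:
  assumes D: "set ds \<subseteq> set ps \<times> set ps" and d: "d \<in> set (oriented ds)"
  shows "fst d \<in> set ps" "snd d \<in> set ps" "fst (fst d) < fst (snd d)" "d \<in> set ds \<or> (snd d, fst d) \<in> set ds"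
  using assms by (auto simp: oriented_def split: if_splits)

lemma oriented_connected:
  assumes D: "set ds \<subseteq> set ps \<times> set ps" and d: "d \<in> set (oriented ds)"
    and Q: "feasible P (map_prod int_point int_point ` set ds) Q"
  shows "M_connected (P \<union> Q) (int_point (fst d)) (int_point (snd d))"
    "M_connected (P \<union> Q) (int_point (snd d)) (int_point (fst d))"
proof -
  have conn: "M_connected (P \<union> Q) (int_point p) (int_point q)" if "(p, q) \<in> set ds" for p q
  proof -
    have "map_prod int_point int_point (p, q) \<in> map_prod int_point int_point ` set ds"
      using that by (rule imageI)
    then show ?thesis using Q by (auto simp: feasible_def)
  qed
  then show "M_connected (P \<union> Q) (int_point (fst d)) (int_point (snd d))"
    "M_connected (P \<union> Q) (int_point (snd d)) (int_point (fst d))"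
    using oriented_props(4)[OF D d] by (metis M_connected_sym prod.collapse)+
qed

lemma accesses_serve_oriented:
  assumes D: "set ds \<subseteq> set ps \<times> set ps" and Q: "feasible P (map_prod int_point int_point ` set ds) Q"
    and t: "t \<in> set (pair_demands ps I (oriented ds))"
  shows "served (accesses G P Q \<inter> set (all_keys I)) t \<and> (fst t = 1 \<or> fst t = - 1)"
proof -
  from t obtain d j where d: "d \<in> set (oriented ds)" and j: "j < G"
    "separated G j (xrank ps (fst (fst d))) (xrank ps (fst (snd d)))" "t = pair_demand ps I d (int j)"
    unfolding pair_demands_iff by blast
  note o = oriented_props[OF D d]
  have "served (accesses G P Q \<inter> valid_keys G (card P)) t"
    unfolding j(3) pair_demand_eq[OF j(1)]
    using o j Q oriented_connected[OF D d Q]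
    by (intro accesses_serve P) (auto simp: feasible_def fst_int_point snd_int_point xrank_eq)
  then show ?thesis by (simp add: set_all_keys P(4) j(3) pair_demand_def)
qed

lemma solution_feasible:
  assumes D: "set ds \<subseteq> set ps \<times> set ps"
    and N: "\<And>t. t \<in> set (pair_demands ps I (oriented ds)) \<Longrightarrow> served (set N) t"
  shows "feasible P (map_prod int_point int_point ` set ds) (int_point ` set (solution_of ps I (oriented ds) N))"
    (is "feasible P _ ?Q")
proof -
  have conn: "M_connected (P \<union> ?Q) (int_point p) (int_point q)" if pq: "(p, q) \<in> set ds" for p q
  proof -
    have mem: "p \<in> set ps" "q \<in> set ps" using D pq by auto
    consider "fst p = fst q" | "fst p < fst q" | "fst q < fst p" by linarith
    then show ?thesis
    proof cases
      case 1
      then have "p = q" using inj_fst mem by (auto dest: inj_onD)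
      then show ?thesis using mem by (auto intro: M_connected_refl)
    next
      case 2
      then have "(p, q) \<in> set (oriented ds)" using pq by (force simp: oriented_def)
      from solution_of_connects[OF this _ _ _ N] 2 mem show ?thesis by simp
    next
      case 3
      then have "(q, p) \<in> set (oriented ds)" using pq by (force simp: oriented_def)
      from solution_of_connects[OF this _ _ _ N] 3 mem
      have "M_connected (P \<union> ?Q) (int_point q) (int_point p)" by simp
      then show ?thesis by (rule M_connected_sym)
    qed
  qed
  have "case z of (p, q) \<Rightarrow> M_connected (P \<union> ?Q) p q" if "z \<in> map_prod int_point int_point ` set ds" for z
  proof -
    from that obtain w where w: "w \<in> set ds" "z = map_prod int_point int_point w" by (rule imageE)
    obtain p q where pq: "w = (p, q)" by (cases w)
    from conn[OF w(1)[unfolded pq]] show ?thesis by (simp only: w(2) pq map_prod_simp prod.case)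
  qed
  then show ?thesis by (simp add: feasible_def)
qed

text \<open>The guess is at most 4|Q| and the net at most 16|Q|, with \<open>G + 2\<close> points
  per access. The endpoints number at most 2|Q|, with \<open>2 * G\<close> points each. Together
  this is 4G + 16(G + 2) = 20G + 32 per point of \<open>Q\<close>.\<close>

lemma solution_approx:
  assumes D: "set ds \<subseteq> set ps \<times> set ps" and Q: "feasible P (map_prod int_point int_point ` set ds) Q"
  shows "feasible P (map_prod int_point int_point ` set ds) (int_point ` set (solution ps ds))"
    "card (set (solution ps ds)) \<le> (20 * G + 32) * card Q"
proof -
  define A where "A = accesses G P Q \<inter> set (all_keys I)"
  define N where "N = small_net (all_keys I) (pair_demands ps I (oriented ds))"
  have finQ: "finite Q" using Q by (simp add: feasible_def)
  have A: "finite A" "A \<subseteq> set (all_keys I)" "card A \<le> 4 * card Q"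
    using card_accesses[OF finQ, of G P] card_mono[OF card_accesses(1)[OF finQ], of A G P]
    by (auto simp: A_def)
  note g = guess_spec[where ds = "pair_demands ps I (oriented ds)",
      OF A(1,2) accesses_serve_oriented[OF D Q, folded A_def]]
  have sol: "solution ps ds = solution_of ps I (oriented ds) N" by (simp add: solution_def N_def)
  show "feasible P (map_prod int_point int_point ` set ds) (int_point ` set (solution ps ds))"
    unfolding sol by (rule solution_feasible[OF D]) (use g(3) in \<open>simp add: N_def\<close>)
  have "int (card (set N)) \<le> 4 * guess (all_keys I) (pair_demands ps I (oriented ds))"
    unfolding N_def small_net_def final_net_def by (rule card_net[OF g(1)])
  then have cN: "card (set N) \<le> 16 * card Q" using g(2) A(3) by linarith
  define E where "E = fst ` set (oriented ds) \<union> snd ` set (oriented ds)"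
  have "card (int_point ` E) \<le> 2 * card Q"
  proof (rule card_demand_endpoints[OF P(1-3) finQ])
    show "int_point ` E \<subseteq> P" using oriented_props(1,2)[OF D] by (auto simp: E_def)
    fix z assume "z \<in> int_point ` E"
    then obtain d where d: "d \<in> set (oriented ds)" "z = int_point (fst d) \<or> z = int_point (snd d)"
      by (auto simp: E_def)
    note o = oriented_props[OF D d(1)]
    have ne: "int_point (fst d) \<noteq> int_point (snd d)" using o(3) by (metis fst_int_point of_int_eq_iff less_irrefl)
    show "\<exists>c \<in> Q. fst c = fst z \<or> snd c = snd z"
      using d(2) o(1,2) ne demand_endpoint_aligned[OF P(2,3)] oriented_connected[OF D d(1) Q] by (metis imageI)
  qed
  then have cE: "card E \<le> 2 * card Q" by (simp add: card_image[OF inj_int_point])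
  have "card (set (solution ps ds)) \<le> 2 * G * card E + (G + 2) * card (set N)"
    unfolding sol E_def by (rule card_solution_of)
  also have "\<dots> \<le> 2 * G * (2 * card Q) + (G + 2) * (16 * card Q)"
    by (intro add_mono mult_left_mono cE cN) auto
  also have "\<dots> = (20 * G + 32) * card Q" by (simp add: algebra_simps)
  finally show "card (set (solution ps ds)) \<le> (20 * G + 32) * card Q" .
qed

end

text \<open>With g = i + 1, minimality gives 2^(i^2) < n and hence i <= 2 sqrt (ln n). For n >= 3
  the root is at least 1, so the constants are absorbed: 20 + 32 + 40 = 92.\<close>

lemma grid_size_bigo: "(\<lambda>n. real (20 * grid_size n + 32)) \<in> O(\<lambda>n. sqrt (ln (real n)))"
proof (rule bigoI[of _ 92], rule eventually_mono[OF eventually_ge_at_top[of 3]])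
  fix n :: nat assume n: "3 \<le> n"
  have "1 \<le> ln (real n)"
  proof -
    have "exp 1 \<le> real n" using exp_le n by (meson numeral_le_real_of_nat_iff order_trans)
    then show ?thesis using n by (subst ln_ge_iff) auto
  qed
  then have one: "1 \<le> sqrt (ln (real n))" by simp
  have "real (grid_size n) \<le> 1 + 2 * sqrt (ln (real n))"
  proof (cases "grid_size n")
    case (Suc i)
    then have "2 ^ (i * i) < n" using less_grid_size_iff[of i n] by simp
    then have "(2::real) ^ (i * i) \<le> real n" by (metis less_imp_le numeral_power_le_of_nat_cancel_iff)
    then have "ln ((2::real) ^ (i * i)) \<le> ln (real n)" using n by (intro ln_mono) auto
    then have "real (i * i) * ln 2 \<le> ln (real n)" by (simp add: ln_realpow)
    \<comment> \<open>A crude bound, chosen so that the square root of the constant is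
      rational.\<close>
    moreover have "1 / 4 \<le> ln (2::real)"
      using ln_le_minus_one[of "1 / 2 :: real"] by (simp add: ln_div)
    then have "real (i * i) * (1 / 4) \<le> real (i * i) * ln 2" by (intro mult_left_mono) auto
    ultimately have "(real i)\<^sup>2 \<le> 4 * ln (real n)" by (simp add: power2_eq_square)
    then have "real i \<le> sqrt (4 * ln (real n))" by (rule real_le_rsqrt)
    also have "\<dots> = 2 * sqrt (ln (real n))" by (simp add: real_sqrt_mult)
    finally show ?thesis using Suc by simp
  qed (use one in simp)
  moreover have "norm (real (20 * grid_size n + 32)) = 20 * real (grid_size n) + 32" by simp
  moreover have "norm (sqrt (ln (real n))) = sqrt (ln (real n))" using one by (simp only: real_norm_def abs_of_nonneg)
  ultimately show "norm (real (20 * grid_size n + 32)) \<le> 92 * norm (sqrt (ln (real n)))"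
    using one by linarith
qed

theorem theorem3:
  "\<exists>(A :: prog) (\<alpha> :: nat \<Rightarrow> real).
     polynomial_time_on {x. \<exists>P D. MinGMConn_instance P D \<and> encodes_instance x P D} A \<and>
     \<alpha> \<in> O(\<lambda>n. sqrt (ln (real n))) \<and>
     (\<forall>P D x y. MinGMConn_instance P D \<and> encodes_instance x P D \<and> outputs A x y \<longrightarrow>
        (\<exists>Q. encodes_solution y Q \<and> feasible P D Q \<and>
             real (card Q) \<le> \<alpha> (card P) * real (opt P D)))"
proof -
  obtain A t where A: "\<And>z. run A (enc z) (enc (algorithm z)) (t z)" and t: "poly_bounded t"
    using ptimeE[OF ptime_algorithm] by blast
  have enc_inst: "\<exists>ps ds. distinct ps \<and> P = int_point ` set ps \<and>
      D = map_prod int_point int_point ` set ds \<and> x = enc (ps, ds)" if "encodes_instance x P D" for x P D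
  proof -
    \<comment> \<open>The encoding of instances is the generic \<open>enc\<close> at the type of the
      input.\<close>
    have pt: "(enc :: int \<times> int \<Rightarrow> val) = enc_pair Leaf Leaf"
      by (rule ext) (simp add: enc_prod_def enc_pair_def)
    then have "(enc :: (int \<times> int) \<times> (int \<times> int) \<Rightarrow> val) = enc_pair (enc_pair Leaf Leaf) (enc_pair Leaf Leaf)"
      by (simp add: enc_prod_def)
    with pt that show ?thesis unfolding encodes_instance_def by (auto simp: enc_list_inst_def)
  qed
  have "polynomial_time_on {x. \<exists>P D. MinGMConn_instance P D \<and> encodes_instance x P D} A"
  proof -
    obtain c k where ck: "\<And>z. t z \<le> c * esize z ^ k" using t unfolding poly_bounded_def by blast
    show ?thesis unfolding polynomial_time_on_def
    proof (intro exI[of _ "monom c k"] ballI)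
      fix x assume "x \<in> {x. \<exists>P D. MinGMConn_instance P D \<and> encodes_instance x P D}"
      then obtain z :: "(int \<times> int) list \<times> ((int \<times> int) \<times> (int \<times> int)) list" where "x = enc z"
        using enc_inst by blast
      then show "\<exists>y t. run A x y t \<and> t \<le> poly (monom c k) (vsize x)"
        using A[of z] ck[of z] unfolding poly_monom by blast
    qed
  qed
  moreover have "\<exists>Q. encodes_solution y Q \<and> feasible P D Q \<and>
      real (card Q) \<le> real (20 * grid_size (card P) + 32) * real (opt P D)"
    if inst: "MinGMConn_instance P D" and x: "encodes_instance x P D" and y: "outputs A x y" for P D x y
  proof -
    obtain ps ds where ps: "distinct ps" "P = int_point ` set ps"
      and ds: "D = map_prod int_point int_point ` set ds" and x': "x = enc (ps, ds)"
      using enc_inst[OF x] by blast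
    interpret point_list ps
      using inst ps inj_on_fst_int_point[of "set ps"] inj_on_snd_int_point[of "set ps"]
      by unfold_locales (simp_all add: MinGMConn_instance_def)
    have D: "set ds \<subseteq> set ps \<times> set ps"
    proof (rule subrelI)
      fix p q assume "(p, q) \<in> set ds"
      then have "map_prod int_point int_point (p, q) \<in> int_point ` set ps \<times> int_point ` set ps"
        using inst unfolding ds ps(2) MinGMConn_instance_def by blast
      then show "(p, q) \<in> set ps \<times> set ps"
        by (simp add: inj_image_mem_iff[OF inj_int_point])
    qed
    \<comment> \<open>By determinism, any output is the computed one.\<close>
    have y': "y = enc (algorithm (ps, ds))"
      using y A[of "(ps, ds)"] run_deterministic unfolding outputs_def x' by blast
    define Q where "Q = int_point ` set (solution ps ds)"
    have "encodes_solution y Q"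
    proof -
      define rs where "rs = map (\<lambda>p. (rat_of_int (fst p), rat_of_int (snd p))) (solution ps ds)"
      have "Q = rat_point ` set rs"
        unfolding Q_def rs_def set_map image_image
        by (intro image_cong) (simp_all add: rat_point_def int_point_def map_prod_def case_prod_beta)
      moreover have "enc_list enc (map (\<lambda>p. ((fst p, 1 :: int), (snd p, 1 :: int))) l) =
          enc_list (enc_pair enc_rat enc_rat) (map (\<lambda>p. (rat_of_int (fst p), rat_of_int (snd p))) l)" for l
        by (induction l) (auto simp: enc_pair_def enc_rat_def)
      then have "y = enc_list (enc_pair enc_rat enc_rat) rs"
        unfolding y' rs_def by (simp add: algorithm_def enc_list_inst_def)
      ultimately show ?thesis unfolding encodes_solution_def by blast
    qed
    moreover obtain Qo where Qo: "feasible P D Qo" "card Qo = opt P D"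
    proof -
      have "feasible P D (fst ` P \<times> snd ` P)"
        using inst unfolding MinGMConn_instance_def by (intro grid_feasible) auto
      then have "\<exists>m Q. feasible P D Q \<and> card Q = m" by blast
      from LeastI_ex[OF this] show ?thesis using that unfolding opt_def by blast
    qed
    note approx = solution_approx[OF D Qo(1)[unfolded ds ps(2)]]
    have "card Q \<le> (20 * grid_size (card P) + 32) * opt P D"
      using approx(2) card_image_le[of "set (solution ps ds)" int_point] P(4) Qo(2) ps(2)
      by (simp add: Q_def)
    then have "real (card Q) \<le> real (20 * grid_size (card P) + 32) * real (opt P D)"
      by (metis of_nat_le_iff of_nat_mult)
    moreover have "feasible P D Q" using approx(1) by (simp add: Q_def ds ps(2))
    ultimately show ?thesis by blast
  qed
  ultimately show ?thesis using grid_size_bigo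
    by (intro exI[of _ A] exI[of _ "\<lambda>n. real (20 * grid_size n + 32)"]) blast
qed

end
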